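(* Let $\nu>0$ and let $n,m\to+\infty$ in such a way that $m/n\to\nu$. Let $F$ be a $2$-connected graph with $v_F\ge 3$ vertices and $e_F$ edges. Assume that $\mathbb{E}X<\infty$ and $0<\sigma_F^2<\infty$, where $\sigma_F^2=\mathrm{Var}(N_F)$ and $N_F$ is the number of copies of $F$ in $G(X,Q)$. Assume, in addition, that $$\mathbb{E}\left(X^{1+s\left(1-\frac{1}{2e_F}\right)}Q^{s}\right)<\infty\qquad\text{for each } s=1,2,\dots,v_F-1.$$ Let $\mathcal{N}_F$ be the number of copies of $F$ in $G_{[n,m]}$. Then $(\mathcal{N}_F-\mathbb{E}\mathcal{N}_F)/(\sigma_F\sqrt{m})$ converges in distribution to the standard normal distribution.
   Context: All graphs are finite and simple. A graph $F$ is $2$-connected if it is connected and stays connected after removal of any one of its vertices. $v_F$ and $e_F$ denote the numbers of vertices and edges of $F$. A copy of $F$ in a graph $G$ is a (not necessarily induced) subgraph of $G$ isomorphic to $F$. Model. $(X,Q)$ is a random vector with values in $\{0,1,2,\dots\}\times[0,1]$ (no independence between $X$ and $Q$ is assumed); its distribution does not depend on $n,m$. For an integer $x\ge 1$ and $p\in[0,1]$, $G(x,p)$ is the Bernoulli random graph on vertex set $\{1,\dots,x\}$ in which each pair of vertices is adjacent independently with probability $p$; $G(0,p)$ is the empty graph with no vertices. $G(X,Q)$ is the corresponding mixture: conditionally on $(X,Q)=(x,p)$ it is distributed as $G(x,p)$. The random graph $G_{[n,m]}$: let $(X_1,Q_1),\dots,(X_m,Q_m)$ be independent copies of $(X,Q)$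 and put $\tilde X_i=\min\{X_i,n\}$. Given these, let $\mathcal{V}_{n,1},\dots,\mathcal{V}_{n,m}$ be independent random subsets of $[n]=\{1,\dots,n\}$, where $\mathcal{V}_{n,i}$ is uniformly distributed among the subsets of size $\tilde X_i$ (so $\mathcal{V}_{n,i}=[n]$ if $X_i\ge n$). Let $G_{n,1},\dots,G_{n,m}$ be independent random graphs (layers), where $G_{n,i}$ has vertex set $\mathcal{V}_{n,i}$ and is obtained from the Bernoulli random graph $G(\tilde X_i,Q_i)$ by a one-to-one mapping of its vertices onto $\mathcal{V}_{n,i}$; that is, each pair of vertices in $\mathcal{V}_{n,i}$ is adjacent in $G_{n,i}$ independently with probability $Q_i$. Let $\mathcal{E}_{n,i}$ be the edge set of $G_{n,i}$. Then $G_{[n,m]}$ is the graph with vertex set $[n]$ and edge set $\mathcal{E}_{n,1}\cup\dots\cup\mathcal{E}_{n,m}$. *)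

theory Defs
  imports "HOL-Probability.Probability"
begin

record 'a ugraph =
  verts :: "'a set"
  edges :: "'a set set"

definition vertex_pairs :: "'a set \<Rightarrow> 'a set set" where
  "vertex_pairs V = {e. e \<subseteq> V \<and> card e = 2}"

definition simple_graph :: "'a ugraph \<Rightarrow> bool" where
  "simple_graph G \<longleftrightarrow> finite (verts G) \<and> edges G \<subseteq> vertex_pairs (verts G)"

definition connected_graph :: "'a ugraph \<Rightarrow> bool" where
  "connected_graph G \<longleftrightarrow> verts G \<noteq> {} \<and>
     (\<forall>u\<in>verts G. \<forall>v\<in>verts G. (u, v) \<in> {(x, y). {x, y} \<in> edges G}\<^sup>*)"

definition remove_vertex :: "'a ugraph \<Rightarrow> 'a \<Rightarrow> 'a ugraph" where
  "remove_vertex G v = \<lparr>verts = verts G - {v}, edges = {e \<in> edges G. v \<notin> e}\<rparr>"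

definition two_connected :: "'a ugraph \<Rightarrow> bool" where
  "two_connected G \<longleftrightarrow> connected_graph G \<and> (\<forall>v\<in>verts G. connected_graph (remove_vertex G v))"

definition subgraph :: "'a ugraph \<Rightarrow> 'a ugraph \<Rightarrow> bool" where
  "subgraph H G \<longleftrightarrow> verts H \<subseteq> verts G \<and> edges H \<subseteq> edges G"

definition isomorphic :: "'a ugraph \<Rightarrow> 'b ugraph \<Rightarrow> bool" where
  "isomorphic F H \<longleftrightarrow> (\<exists>f. bij_betw f (verts F) (verts H) \<and> edges H = (\<lambda>e. f ` e) ` edges F)"

definition copies :: "'a ugraph \<Rightarrow> 'b ugraph \<Rightarrow> 'b ugraph set" where
  "copies F G = {H. simple_graph H \<and> subgraph H G \<and> isomorphic F H}"

definition num_copies :: "'a ugraph \<Rightarrow> 'b ugraph \<Rightarrow> nat" where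
  "num_copies F G = card (copies F G)"

definition bernoulli_graph :: "nat set \<Rightarrow> real \<Rightarrow> nat ugraph pmf" where
  "bernoulli_graph V p =
     map_pmf (\<lambda>b. \<lparr>verts = V, edges = {e \<in> vertex_pairs V. b e}\<rparr>)
       (Pi_pmf (vertex_pairs V) False (\<lambda>_. bernoulli_pmf p))"

definition layer :: "nat \<Rightarrow> nat \<Rightarrow> real \<Rightarrow> nat ugraph pmf" where
  "layer n x p =
     bind_pmf (pmf_of_set {V. V \<subseteq> {1..n} \<and> card V = min x n}) (\<lambda>V. bernoulli_graph V p)"

definition union_layers :: "nat \<Rightarrow> nat \<Rightarrow> (nat \<Rightarrow> nat ugraph) \<Rightarrow> nat ugraph" where
  "union_layers n m L = \<lparr>verts = {1..n}, edges = (\<Union>i\<in>{1..m}. edges (L i))\<rparr>"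

text \<open>
  In the following, \<open>P\<close> is the joint law of \<open>(X, Q)\<close>. The laws of \<open>G(X, Q)\<close> and \<open>G\<^sub>[\<^sub>n\<^sub>,\<^sub>m\<^sub>]\<close> are
  discrete conditionally on the (possibly non-discrete) weights; the monadic bind integrates the
  weights out. The required measurability is proved below. Note that \<open>bernoulli_pmf\<close> clamps its
  parameter to \<open>[0, 1]\<close>, so the kernels are defined on all of \<open>nat \<times> real\<close>.
\<close>

definition mixed_bernoulli_graph :: "(nat \<times> real) measure \<Rightarrow> nat ugraph measure" where
  "mixed_bernoulli_graph P = P \<bind> (\<lambda>(x, p). measure_pmf (bernoulli_graph {1..x} p))"

definition layered_graph_given :: "nat \<Rightarrow> nat \<Rightarrow> (nat \<Rightarrow> nat \<times> real) \<Rightarrow> nat ugraph pmf" where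
  "layered_graph_given n m w =
     map_pmf (union_layers n m)
       (Pi_pmf {1..m} \<lparr>verts = {}, edges = {}\<rparr> (\<lambda>i. layer n (fst (w i)) (snd (w i))))"

definition layered_graph :: "(nat \<times> real) measure \<Rightarrow> nat \<Rightarrow> nat \<Rightarrow> nat ugraph measure" where
  "layered_graph P n m =
     (\<Pi>\<^sub>M i\<in>{1..m}. P) \<bind> (\<lambda>w. measure_pmf (layered_graph_given n m w))"

lemma finite_vertex_pairs: "finite V \<Longrightarrow> finite (vertex_pairs V)"
  unfolding vertex_pairs_def by auto

lemma finite_graphs: "finite V \<Longrightarrow> finite {G :: 'a ugraph. verts G \<subseteq> V \<and> edges G \<subseteq> vertex_pairs V}"
proof -
  assume V: "finite V"
  have "{G :: 'a ugraph. verts G \<subseteq> V \<and> edges G \<subseteq> vertex_pairs V}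
    \<subseteq> (\<lambda>(A, B). \<lparr>verts = A, edges = B\<rparr>) ` (Pow V \<times> Pow (vertex_pairs V))"
    (is "_ \<subseteq> ?R")
  proof
    fix G :: "'a ugraph" assume "G \<in> {G. verts G \<subseteq> V \<and> edges G \<subseteq> vertex_pairs V}"
    then show "G \<in> ?R" by (intro image_eqI[where x = "(verts G, edges G)"]) auto
  qed
  then show ?thesis
    by (rule finite_subset) (simp add: V finite_vertex_pairs)
qed

lemma measurable_pmf_kernel:
  fixes f :: "'a \<Rightarrow> 'b pmf"
  assumes S: "finite S" "\<And>w. w \<in> space N \<Longrightarrow> set_pmf (f w) \<subseteq> S"
    and m: "\<And>y. y \<in> S \<Longrightarrow> (\<lambda>w. pmf (f w) y) \<in> borel_measurable N"
  shows "(\<lambda>w. measure_pmf (f w)) \<in> N \<rightarrow>\<^sub>M prob_algebra (count_space UNIV)"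
    and "\<And>A. (\<lambda>w. measure_pmf.prob (f w) A) \<in> borel_measurable N"
proof -
  have eq: "measure_pmf.prob (f w) A = (\<Sum>y\<in>S \<inter> A. pmf (f w) y)" if "w \<in> space N" for w A
  proof -
    have "measure_pmf.prob (f w) A = measure_pmf.prob (f w) (A \<inter> set_pmf (f w))"
      by (simp add: measure_Int_set_pmf)
    also have "\<dots> = measure_pmf.prob (f w) (S \<inter> A)"
      by (rule measure_prob_cong_0) (use S(2)[OF that] in \<open>auto simp: set_pmf_eq\<close>)
    finally show ?thesis using S(1) by (simp add: measure_measure_pmf_finite)
  qed
  show prob: "(\<lambda>w. measure_pmf.prob (f w) A) \<in> borel_measurable N" for A
    by (subst measurable_cong[OF eq]) (auto intro!: borel_measurable_sum m)
  show "(\<lambda>w. measure_pmf (f w)) \<in> N \<rightarrow>\<^sub>M prob_algebra (count_space UNIV)"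
  proof (rule measurable_prob_algebraI)
    show "(\<lambda>w. measure_pmf (f w)) \<in> N \<rightarrow>\<^sub>M subprob_algebra (count_space UNIV)"
      by (rule measurable_subprob_algebra)
        (auto simp: measure_pmf.emeasure_eq_measure intro: prob prob_space_imp_subprob_space
          prob_space_measure_pmf)
  qed (rule prob_space_measure_pmf)
qed

lemma bernoulli_graph_support:
  "finite V \<Longrightarrow> set_pmf (bernoulli_graph V p) \<subseteq> {G. verts G = V \<and> edges G \<subseteq> vertex_pairs V}"
  unfolding bernoulli_graph_def by auto

lemma measurable_pmf_bernoulli_graph:
  assumes "finite V"
  shows "(\<lambda>p. pmf (bernoulli_graph V p) G) \<in> borel_measurable borel"
  unfolding bernoulli_graph_def pmf_map
proof (rule measurable_pmf_kernel(2))
  let ?P = "vertex_pairs V"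
  have fin: "finite ?P" using assms by (rule finite_vertex_pairs)
  show "finite (PiE_dflt ?P False (\<lambda>_. UNIV :: bool set))" using fin by auto
  show "set_pmf (Pi_pmf ?P False (\<lambda>_. bernoulli_pmf p)) \<subseteq> PiE_dflt ?P False (\<lambda>_. UNIV)" for p
    using set_Pi_pmf_subset[OF fin] by (fastforce simp: PiE_dflt_def)
  have bern: "pmf (bernoulli_pmf p) b = (if b then min 1 (max 0 p) else 1 - min 1 (max 0 p))"
    for p b by (simp add: bernoulli_pmf.rep_eq)
  show "(\<lambda>p. pmf (Pi_pmf ?P False (\<lambda>_. bernoulli_pmf p)) b) \<in> borel_measurable borel" for b
    unfolding pmf_Pi[OF fin] bern by (cases "\<forall>x. x \<notin> ?P \<longrightarrow> b x = False") simp_all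
qed

lemma subset_layers_nonempty:
  "finite {V. V \<subseteq> {1..n} \<and> card V = min x n}" "{V. V \<subseteq> {1..n} \<and> card V = min x (n::nat)} \<noteq> {}"
proof -
  have "{1..min x n} \<in> {V. V \<subseteq> {1..n} \<and> card V = min x n}" by auto
  then show "{V. V \<subseteq> {1..n} \<and> card V = min x n} \<noteq> {}" by blast
qed auto

lemma layer_support:
  "set_pmf (layer n x p) \<subseteq> {G. verts G \<subseteq> {1..n} \<and> edges G \<subseteq> vertex_pairs {1..n}}"
proof
  fix G assume "G \<in> set_pmf (layer n x p)"
  then obtain V where V: "V \<subseteq> {1..n}" "G \<in> set_pmf (bernoulli_graph V p)"
    unfolding layer_def set_bind_pmf set_pmf_of_set[OF subset_layers_nonempty(2,1)] by blast
  then have "verts G = V \<and> edges G \<subseteq> vertex_pairs V"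
    using bernoulli_graph_support[of V p] finite_subset by blast
  with V(1) show "G \<in> {G. verts G \<subseteq> {1..n} \<and> edges G \<subseteq> vertex_pairs {1..n}}"
    by (auto simp: vertex_pairs_def)
qed

lemma measurable_pmf_layer:
  "(\<lambda>p. pmf (layer n x p) G) \<in> borel_measurable borel"
proof -
  have "pmf (layer n x p) G = (\<Sum>V | V \<subseteq> {1..n} \<and> card V = min x n.
      pmf (bernoulli_graph V p) G / card {V. V \<subseteq> {1..n} \<and> card V = min x n})" for p
    unfolding layer_def pmf_bind
    by (subst integral_pmf_of_set[OF subset_layers_nonempty(2,1)])
      (simp add: sum_divide_distrib)
  then show ?thesis
    by (auto intro!: borel_measurable_sum borel_measurable_divide measurable_pmf_bernoulli_graph
        intro: finite_subset)
qed

lemma measurable_mixed_kernel: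
  "(\<lambda>(x, p). measure_pmf (bernoulli_graph {1..x} p))
     \<in> count_space UNIV \<Otimes>\<^sub>M borel \<rightarrow>\<^sub>M prob_algebra (count_space UNIV)"
proof (rule measurable_pair_measure_countable1)
  fix x :: nat
  have "(\<lambda>p. measure_pmf (bernoulli_graph {1..x} p)) \<in> borel \<rightarrow>\<^sub>M prob_algebra (count_space UNIV)"
    by (rule measurable_pmf_kernel(1)[OF finite_graphs[of "{1..x}"]])
      (use bernoulli_graph_support[of "{1..x}"] measurable_pmf_bernoulli_graph in auto)
  then show "(\<lambda>p. case (x, p) of (x, p) \<Rightarrow> measure_pmf (bernoulli_graph {1..x} p))
    \<in> borel \<rightarrow>\<^sub>M prob_algebra (count_space UNIV)" by simp
qed simp

lemma measurable_layered_kernel: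
  assumes P: "sets P = sets (count_space UNIV \<Otimes>\<^sub>M borel)"
  shows "(\<lambda>w. measure_pmf (layered_graph_given n m w))
     \<in> (\<Pi>\<^sub>M i\<in>{1..m}. P) \<rightarrow>\<^sub>M prob_algebra (count_space UNIV)"
proof -
  let ?N = "\<Pi>\<^sub>M i\<in>{1..m}. P"
  let ?d = "\<lparr>verts = {}, edges = {}\<rparr> :: nat ugraph"
  let ?S = "{G :: nat ugraph. verts G \<subseteq> {1..n} \<and> edges G \<subseteq> vertex_pairs {1..n}}"
  let ?L = "\<lambda>w. Pi_pmf {1..m} ?d (\<lambda>i. layer n (fst (w i)) (snd (w i)))"
  have layer: "(\<lambda>z. pmf (layer n (fst z) (snd z)) G) \<in> borel_measurable P" for G
  proof -
    have "(\<lambda>(x, p). pmf (layer n x p) G) \<in> borel_measurable (count_space UNIV \<Otimes>\<^sub>M borel)"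
      by (rule measurable_pair_measure_countable1) (simp_all add: measurable_pmf_layer)
    then show ?thesis by (simp add: case_prod_beta measurable_cong_sets[OF P refl])
  qed
  have fin: "finite (PiE_dflt {1..m} ?d (\<lambda>_. ?S))"
    by (intro finite_PiE_dflt) (auto simp: finite_graphs)
  have supp: "set_pmf (?L w) \<subseteq> PiE_dflt {1..m} ?d (\<lambda>_. ?S)" for w
    using layer_support by (fastforce simp: set_Pi_pmf PiE_dflt_def)
  have meas: "(\<lambda>w. pmf (?L w) L) \<in> borel_measurable ?N" for L
  proof (cases "\<forall>i. i \<notin> {1..m} \<longrightarrow> L i = ?d")
    case True
    have "(\<lambda>w. pmf (layer n (fst (w i)) (snd (w i))) (L i)) \<in> borel_measurable ?N"
      if "i \<in> {1..m}" for i
      by (rule measurable_compose[where f = "\<lambda>w. w i", OF _ layer])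
        (rule measurable_component_singleton[OF that])
    then have "(\<lambda>w. \<Prod>i\<in>{1..m}. pmf (layer n (fst (w i)) (snd (w i))) (L i)) \<in> borel_measurable ?N"
      by (rule borel_measurable_prod)
    then show ?thesis using True by (simp add: pmf_Pi)
  next
    case False
    then have "pmf (?L w) L = 0" for w by (intro pmf_Pi_outside) auto
    then show ?thesis by simp
  qed
  have prob: "(\<lambda>w. measure_pmf.prob (?L w) A) \<in> borel_measurable ?N" for A
    by (rule measurable_pmf_kernel(2)[OF fin supp meas])
  show ?thesis
    by (rule measurable_pmf_kernel(1)[where
          S = "union_layers n m ` PiE_dflt {1..m} ?d (\<lambda>_. ?S)"])
      (use fin supp prob in \<open>auto simp: layered_graph_given_def pmf_map\<close>)
qed

lemma
  assumes "prob_space P" "sets P = sets (count_space UNIV \<Otimes>\<^sub>M borel)"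
  shows prob_space_mixed_bernoulli_graph: "prob_space (mixed_bernoulli_graph P)"
    and sets_mixed_bernoulli_graph: "sets (mixed_bernoulli_graph P) = UNIV"
proof -
  have "P \<in> space (prob_algebra (count_space UNIV \<Otimes>\<^sub>M borel))"
    using assms by (simp add: space_prob_algebra)
  from prob_space_bind'[OF this measurable_mixed_kernel] sets_bind'[OF this measurable_mixed_kernel]
  show "prob_space (mixed_bernoulli_graph P)" "sets (mixed_bernoulli_graph P) = UNIV"
    by (auto simp: mixed_bernoulli_graph_def)
qed

lemma
  assumes "prob_space P" "sets P = sets (count_space UNIV \<Otimes>\<^sub>M borel)"
  shows prob_space_layered_graph: "prob_space (layered_graph P n m)"
    and sets_layered_graph: "sets (layered_graph P n m) = UNIV"
proof -
  have "(\<Pi>\<^sub>M i\<in>{1..m}. P) \<in> space (prob_algebra (\<Pi>\<^sub>M i\<in>{1..m}. P))"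
    using assms(1) by (auto simp: space_prob_algebra intro: prob_space_PiM)
  from prob_space_bind'[OF this measurable_layered_kernel[OF assms(2)]] sets_bind'[OF this measurable_layered_kernel[OF assms(2)]]
  show "prob_space (layered_graph P n m)" "sets (layered_graph P n m) = UNIV"
    by (auto simp: layered_graph_def)
qed

end

theory Submission
  imports Defs
begin

text \<open>
  Let \<open>S\<close> be the sum over all layers of the number of copies of \<open>F\<close> in that layer. The number of
  copies in the union differs from \<open>S\<close> by at most the number of pairs of a potential copy \<open>H\<close> and a
  non-constant colouring of its edges by layers such that each edge lies in the layer of its
  colour. An edge set \<open>A\<close> lies in a given layer with probability at most
  \<open>\<mu> s = E ((min X n / n)\<^bsup>s + 1\<^esup> Q\<^bsup>s\<^esup>)\<close>, where \<open>s = min (card A) (card (\<Union>A) - 1)\<close>, and by dominated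
  convergence the moment condition gives \<open>m \<mu> s = o(n\<^bsup>- s (1 - 1 / (2 e))\<^esup>)\<close>. Since \<open>F\<close> is
  2-connected, these \<open>s\<close>, summed over the colour classes of a non-constant colouring, make up at
  least the number \<open>h\<close> of vertices of \<open>F\<close>. There are at most \<open>n\<^bsup>h\<^esup>\<close> potential copies, so the
  expected difference is \<open>o(n\<^bsup>h / (2 e)\<^esup>)\<close>, hence \<open>o(sqrt n)\<close>, because \<open>h \<le> e\<close>.

  The terms of \<open>S\<close> are independent with the law of the number of copies of \<open>F\<close> in the subgraph of
  \<open>G(X, Q)\<close> induced by the first \<open>n\<close> vertices. This number is dominated by, and converges to,
  the number of copies in \<open>G(X, Q)\<close>, so the central limit theorem holds for \<open>S\<close>.
\<close>

section \<open>Edge colourings of 2-connected graphs\<close>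

lemma connected_graph_crossing_edge:
  assumes "connected_graph G" "x \<in> verts G" "x \<in> U" "y \<in> verts G" "y \<notin> U"
  obtains a b where "{a, b} \<in> edges G" "a \<in> U" "b \<notin> U"
proof -
  have "(x, y) \<in> {(x, y). {x, y} \<in> edges G}\<^sup>*"
    using assms unfolding connected_graph_def by blast
  then have "y \<notin> U \<longrightarrow> (\<exists>a b. {a, b} \<in> edges G \<and> a \<in> U \<and> b \<notin> U)"
    by (induction rule: rtrancl_induct) (use assms(3) in auto)
  then show thesis using assms(5) that by blast
qed

text \<open>Grow a vertex set from \<open>x\<close> by adjoining one block \<open>B j\<close> at a
  time. Connectivity provides an edge leaving the current set; the block covering that edge already
  meets the set, so it brings at most \<open>card (B j) - 1\<close> new vertices.\<close>

lemma connected_graph_card_le: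
  assumes conn: "connected_graph G"
    and J: "finite J" "\<And>j. j \<in> J \<Longrightarrow> finite (B j)"
    and cover: "\<And>e. e \<in> edges G \<Longrightarrow> \<exists>j\<in>J. e \<subseteq> B j"
  shows "card (verts G) \<le> 1 + (\<Sum>j\<in>J. card (B j) - 1)"
proof -
  obtain x where x: "x \<in> verts G" using conn unfolding connected_graph_def by blast
  define U where "U J' = insert x (\<Union>(B ` J'))" for J'
  \<comment> \<open>These are the subfamilies that obey the bound so far; a maximal one has to reach
    all vertices.\<close>
  define good where "good = {J'. J' \<subseteq> J \<and> card (U J') \<le> 1 + (\<Sum>j\<in>J'. card (B j) - 1)}"
  have "finite good" "good \<noteq> {}"
    unfolding good_def using J(1) by (auto intro: exI[of _ "{}"] simp: U_def)
  from finite_has_maximal[OF this] obtain J' where J': "J' \<in> good"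
    and max: "\<And>K. K \<in> good \<Longrightarrow> J' \<subseteq> K \<Longrightarrow> J' = K" by blast
  have sub: "J' \<subseteq> J" and fin: "finite J'" and le: "card (U J') \<le> 1 + (\<Sum>j\<in>J'. card (B j) - 1)"
    using J' J(1) finite_subset unfolding good_def by auto
  have finU: "finite (U J')" using fin sub J(2) unfolding U_def by auto
  have "verts G \<subseteq> U J'"
  proof (rule ccontr)
    assume "\<not> verts G \<subseteq> U J'"
    then obtain y where y: "y \<in> verts G" "y \<notin> U J'" by blast
    obtain a b where ab: "{a, b} \<in> edges G" "a \<in> U J'" "b \<notin> U J'"
      by (rule connected_graph_crossing_edge[OF conn x _ y]) (auto simp: U_def)
    then obtain j where j: "j \<in> J" "{a, b} \<subseteq> B j" using cover by meson
    have "j \<notin> J'" using ab(3) j(2) unfolding U_def by blast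
    \<comment> \<open>The endpoint \<open>a\<close> is already in \<open>U J'\<close>, which
      accounts for the subtracted 1.\<close>
    have "U (insert j J') = U J' \<union> (B j - {a})" using ab(2) unfolding U_def by auto
    then have "card (U (insert j J')) \<le> card (U J') + (card (B j) - 1)"
      using card_Un_le[of "U J'" "B j - {a}"] j J(2) by (simp add: card_Diff_singleton)
    also have "\<dots> \<le> 1 + (\<Sum>j\<in>insert j J'. card (B j) - 1)"
      using le fin \<open>j \<notin> J'\<close> by simp
    finally have "insert j J' \<in> good" using sub j unfolding good_def by blast
    from max[OF this] \<open>j \<notin> J'\<close> show False by blast
  qed
  then have "card (verts G) \<le> card (U J')" using finU by (rule card_mono[rotated])
  also have "\<dots> \<le> 1 + (\<Sum>j\<in>J'. card (B j) - 1)" by (rule le)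
  also have "\<dots> \<le> 1 + (\<Sum>j\<in>J. card (B j) - 1)"
    using sum_mono2[OF J(1) sub, of "\<lambda>j. card (B j) - 1"] by simp
  finally show ?thesis .
qed

lemma simple_graph_edgeE:
  assumes "simple_graph G" "e \<in> edges G"
  obtains a b where "e = {a, b}" "a \<noteq> b" "a \<in> verts G" "b \<in> verts G"
  using assms unfolding simple_graph_def vertex_pairs_def
  by (smt (verit) card_2_iff insert_subset mem_Collect_eq subset_iff)

text \<open>The colour classes, as sets of vertices, cover the connected graph \<open>F - v\<close>; taking for \<open>v\<close>
  a vertex that meets two colours gains 2 over the tree bound for \<open>F - v\<close>.\<close>
lemma two_connected_colouring_span:
  assumes simple: "simple_graph F" and conn: "two_connected F" and card3: "card (verts F) \<ge> 3"
    and e12: "e\<^sub>1 \<in> edges F" "e\<^sub>2 \<in> edges F" "c e\<^sub>1 \<noteq> c e\<^sub>2"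
  shows "card (verts F) \<le> (\<Sum>j\<in>c ` edges F. card (\<Union>{e \<in> edges F. c e = j}) - 1)"
proof -
  have finV: "finite (verts F)" and edges: "edges F \<subseteq> vertex_pairs (verts F)"
    using simple unfolding simple_graph_def by auto
  have finE: "finite (edges F)" using finite_subset[OF edges finite_vertex_pairs[OF finV]] .
  define W where "W j = \<Union>{e \<in> edges F. c e = j}" for j
  have W: "W j \<subseteq> verts F" for j using edges unfolding W_def vertex_pairs_def by auto
  have finW: "finite (W j)" for j using finite_subset[OF W finV] .
  \<comment> \<open>If the class of \<open>e\<^sub>1\<close> spans all vertices, an endpoint of
    \<open>e\<^sub>2\<close> meets two colours. Otherwise an edge leaving that span has another
    colour, and its inner endpoint \<open>a\<close> lies in both spans.\<close>
  obtain v where v: "v \<in> verts F" "\<exists>i\<in>c ` edges F. \<exists>j\<in>c ` edges F. i \<noteq> j \<and> v \<in> W i \<and> v \<in> W j"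
  proof (cases "verts F \<subseteq> W (c e\<^sub>1)")
    case True
    obtain a b where "e\<^sub>2 = {a, b}" "a \<in> verts F" by (rule simple_graph_edgeE[OF simple e12(2)])
    then have "a \<in> W (c e\<^sub>1)" "a \<in> W (c e\<^sub>2)" "a \<in> verts F" using True e12 unfolding W_def by auto
    then show thesis using that e12 by (metis imageI)
  next
    case False
    then obtain y where y: "y \<in> verts F" "y \<notin> W (c e\<^sub>1)" by blast
    obtain a' b' where e1: "e\<^sub>1 = {a', b'}" "a' \<in> verts F" by (rule simple_graph_edgeE[OF simple e12(1)])
    have "a' \<in> W (c e\<^sub>1)" using e1 e12 unfolding W_def by auto
    moreover have "connected_graph F" using conn unfolding two_connected_def by blast
    ultimately obtain a b where ab: "{a, b} \<in> edges F" "a \<in> W (c e\<^sub>1)" "b \<notin> W (c e\<^sub>1)"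
      using connected_graph_crossing_edge[OF _ e1(2) _ y] by metis
    then have "c {a, b} \<noteq> c e\<^sub>1" "a \<in> W (c {a, b})" "a \<in> verts F"
      using W unfolding W_def by auto
    then show thesis using that ab e12 by (metis imageI)
  qed
  then obtain i j where ij: "i \<in> c ` edges F" "j \<in> c ` edges F" "i \<noteq> j" "v \<in> W i" "v \<in> W j" by blast
  let ?G = "remove_vertex F v" and ?J = "c ` edges F"
  have "connected_graph ?G" using conn v(1) unfolding two_connected_def by blast
  then have "card (verts ?G) \<le> 1 + (\<Sum>j\<in>?J. card (W j - {v}) - 1)"
  proof (rule connected_graph_card_le)
    fix e assume "e \<in> edges ?G"
    then show "\<exists>j\<in>?J. e \<subseteq> W j - {v}" unfolding remove_vertex_def W_def by auto
  qed (use finE finW in auto)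
  moreover have "card (verts ?G) = card (verts F) - 1"
    using v finV by (simp add: remove_vertex_def)
  \<comment> \<open>The spans of \<open>i\<close> and \<open>j\<close> both lose \<open>v\<close>,
    whence the gain of 2. Every class contains an edge and so spans at least two vertices, which
    keeps the truncated subtractions exact.\<close>
  moreover have "(\<Sum>j\<in>?J. card (W j - {v}) - 1) + 2 \<le> (\<Sum>j\<in>?J. card (W j) - 1)"
  proof -
    have "(card (W k - {v}) - 1) + (if k \<in> {i, j} then 1 else 0) \<le> card (W k) - 1" if "k \<in> ?J" for k
    proof -
      from that obtain e where e: "e \<in> edges F" "c e = k" by blast
      obtain a b where ab: "e = {a, b}" "a \<noteq> b" by (rule simple_graph_edgeE[OF simple e(1)])
      have "{a, b} \<subseteq> W k" using e ab unfolding W_def by auto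
      then have "2 \<le> card (W k)" using card_mono[OF finW, of "{a, b}" k] ab by simp
      moreover have "card (W k - {v}) = (if v \<in> W k then card (W k) - 1 else card (W k))"
        using finW by (simp add: card_Diff_singleton_if)
      ultimately show ?thesis using ij by auto
    qed
    then have "(\<Sum>k\<in>?J. (card (W k - {v}) - 1) + (if k \<in> {i, j} then 1 else 0)) \<le> (\<Sum>k\<in>?J. card (W k) - 1)"
      by (rule sum_mono)
    moreover have "(\<Sum>k\<in>?J. if k \<in> {i, j} then 1 else 0) = (2::nat)"
    proof -
      have "?J \<inter> {k. k = i \<or> k = j} = {i, j}" using ij by auto
      then show ?thesis using finE ij by (simp add: sum.If_cases)
    qed
    ultimately show ?thesis by (simp add: sum.distrib)
  qed
  ultimately show ?thesis using card3 unfolding W_def by linarith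
qed

text \<open>Classes with few edges are split into single edges before the previous lemma is applied.\<close>
lemma two_connected_colouring_rank:
  assumes simple: "simple_graph F" and conn: "two_connected F" and card3: "card (verts F) \<ge> 3"
    and e12: "e\<^sub>1 \<in> edges F" "e\<^sub>2 \<in> edges F" "c e\<^sub>1 \<noteq> c e\<^sub>2"
  shows "card (verts F) \<le> (\<Sum>j\<in>c ` edges F. min (card {e \<in> edges F. c e = j})
    (card (\<Union>{e \<in> edges F. c e = j}) - 1))"
proof -
  have finE: "finite (edges F)"
    using simple finite_subset[OF _ finite_vertex_pairs] unfolding simple_graph_def by blast
  define C where "C j = {e \<in> edges F. c e = j}" for j
  define few where "few j \<longleftrightarrow> card (C j) \<le> card (\<Union>(C j)) - 1" for j
  \<comment> \<open>\<open>c'\<close> refines \<open>c\<close>; its first component keeps the old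
    colour, so the sum over the new classes can be regrouped by old colours.\<close>
  define c' where "c' e = (c e, if few (c e) then Some e else None)" for e
  define g where "g k = card (\<Union>{e \<in> edges F. c' e = k}) - 1" for k
  have "card (verts F) \<le> (\<Sum>k\<in>c' ` edges F. g k)"
    unfolding g_def
    by (rule two_connected_colouring_span[OF simple conn card3 e12(1,2)]) (simp add: c'_def e12)
  also have "\<dots> = (\<Sum>j\<in>fst ` c' ` edges F. \<Sum>k | k \<in> c' ` edges F \<and> fst k = j. g k)"
    by (rule sum.image_gen) (simp add: finE)
  also have "fst ` c' ` edges F = c ` edges F" by (simp add: image_image c'_def)
  also have "(\<Sum>j\<in>c ` edges F. \<Sum>k | k \<in> c' ` edges F \<and> fst k = j. g k)
    \<le> (\<Sum>j\<in>c ` edges F. min (card (C j)) (card (\<Union>(C j)) - 1))"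
  proof (rule sum_mono)
    fix j assume "j \<in> c ` edges F"
    show "(\<Sum>k | k \<in> c' ` edges F \<and> fst k = j. g k) \<le> min (card (C j)) (card (\<Union>(C j)) - 1)"
    \<comment> \<open>A split class contributes 1 for each edge, an unsplit one its span minus 1;
      \<open>few\<close> selects whichever attains the minimum.\<close>
    proof (cases "few j")
      case True
      have K: "{k \<in> c' ` edges F. fst k = j} = (\<lambda>e. (j, Some e)) ` C j"
        using True unfolding c'_def C_def by auto
      have g: "g (j, Some e) = 1" if "e \<in> C j" for e
      proof -
        have "{e' \<in> edges F. c' e' = (j, Some e)} = {e}"
          using that True unfolding C_def c'_def by auto
        moreover have "card e = 2"
          using that simple unfolding C_def simple_graph_def vertex_pairs_def by auto
        ultimately show ?thesis unfolding g_def by simp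
      qed
      have "(\<Sum>k | k \<in> c' ` edges F \<and> fst k = j. g k) = (\<Sum>e\<in>C j. g (j, Some e))"
        unfolding K by (subst sum.reindex) (auto simp: inj_on_def)
      also have "\<dots> = card (C j)" using g by simp
      finally show ?thesis using True unfolding few_def by simp
    next
      case False
      then have K: "{k \<in> c' ` edges F. fst k = j} = {(j, None)}"
        using \<open>j \<in> c ` edges F\<close> unfolding c'_def by force
      have "{e \<in> edges F. c' e = (j, None)} = C j"
        using False unfolding c'_def C_def by auto
      then show ?thesis using False unfolding K few_def by (simp add: g_def)
    qed
  qed
  finally show ?thesis unfolding C_def .
qed

text \<open>One edge leaves a singleton, and a third vertex forces another edge that leaves the pair
  spanned by the first. Two edges are what makes non-constant colourings possible.\<close>

lemma two_connected_distinct_edges: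
  assumes simple: "simple_graph F" and conn: "two_connected F" and card3: "card (verts F) \<ge> 3"
  obtains e\<^sub>1 e\<^sub>2 where "e\<^sub>1 \<in> edges F" "e\<^sub>2 \<in> edges F" "e\<^sub>1 \<noteq> e\<^sub>2"
proof -
  have finV: "finite (verts F)" using simple unfolding simple_graph_def by auto
  have c: "connected_graph F" using conn unfolding two_connected_def by blast
  obtain x y where xy: "x \<in> verts F" "y \<in> verts F" "x \<noteq> y"
    using card3 by (metis card_2_iff' obtain_subset_with_card_n insertCI numeral_2_eq_2 numeral_3_eq_3
        Suc_leD subset_iff)
  obtain a b where ab: "{a, b} \<in> edges F"
    by (rule connected_graph_crossing_edge[OF c xy(1) _ xy(2), of "{x}"]) (use xy in auto)
  then have abV: "a \<in> verts F" "{a, b} \<subseteq> verts F"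
    using simple unfolding simple_graph_def vertex_pairs_def by auto
  have "\<not> verts F \<subseteq> {a, b}"
  proof
    assume "verts F \<subseteq> {a, b}"
    then have "card (verts F) \<le> card {a, b}" by (intro card_mono) auto
    also have "\<dots> \<le> 2" by (simp add: card_insert_if)
    finally show False using card3 by simp
  qed
  then obtain z where z: "z \<in> verts F" "z \<notin> {a, b}" by blast
  obtain a' b' where "{a', b'} \<in> edges F" "b' \<notin> {a, b}"
    by (rule connected_graph_crossing_edge[OF c abV(1) _ z]) auto
  then show thesis using that[OF ab] by (metis insertCI)
qed

text \<open>Colour every edge by itself: each class has rank at most 1, so the rank bound turns into
  a bound by the number of edges. It later gives \<open>h / (2 * e) \<le> 1 / 2\<close>.\<close>

lemma two_connected_card_edges:
  assumes simple: "simple_graph F" and conn: "two_connected F" and card3: "card (verts F) \<ge> 3"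
  shows "card (verts F) \<le> card (edges F)"
proof -
  obtain e\<^sub>1 e\<^sub>2 where e12: "e\<^sub>1 \<in> edges F" "e\<^sub>2 \<in> edges F" "e\<^sub>1 \<noteq> e\<^sub>2"
    by (rule two_connected_distinct_edges[OF assms])
  have "card (verts F) \<le> (\<Sum>j\<in>(\<lambda>e. e) ` edges F. min (card {e \<in> edges F. e = j})
    (card (\<Union>{e \<in> edges F. e = j}) - 1))"
    by (rule two_connected_colouring_rank[OF assms e12(1,2)]) (simp add: e12)
  also have "\<dots> \<le> (\<Sum>j\<in>edges F. 1)"
    unfolding image_ident
  proof (rule sum_mono)
    fix j assume "j \<in> edges F"
    then have "{e \<in> edges F. e = j} = {j}" by auto
    then show "min (card {e \<in> edges F. e = j}) (card (\<Union>{e \<in> edges F. e = j}) - 1) \<le> 1" by simp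
  qed
  finally show ?thesis by simp
qed

text \<open>Without isolated vertices a copy is determined by its edges, and it lies in a graph as
  soon as its edges do.\<close>

lemma two_connected_verts_eq_Union_edges:
  assumes simple: "simple_graph F" and conn: "two_connected F" and card3: "card (verts F) \<ge> 3"
  shows "verts F = \<Union>(edges F)"
proof
  have c: "connected_graph F" using conn unfolding two_connected_def by blast
  show "verts F \<subseteq> \<Union>(edges F)"
  proof
    fix x assume x: "x \<in> verts F"
    have "\<not> verts F \<subseteq> {x}" using card3 card_mono[of "{x}" "verts F"] by auto
    then obtain y where y: "y \<in> verts F" "y \<notin> {x}" by blast
    obtain a b where "{a, b} \<in> edges F" "a \<in> {x}"
      by (rule connected_graph_crossing_edge[OF c x _ y]) auto
    then show "x \<in> \<Union>(edges F)" by blast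
  qed
qed (use simple in \<open>auto simp: simple_graph_def vertex_pairs_def\<close>)

section \<open>Copies of a fixed graph\<close>

lemma finite_copies:
  assumes "finite (verts G)"
  shows "finite (copies F G)"
proof (rule finite_subset)
  show "copies F G \<subseteq> {H. verts H \<subseteq> verts G \<and> edges H \<subseteq> vertex_pairs (verts G)}"
  proof
    fix H assume "H \<in> copies F G"
    then have "verts H \<subseteq> verts G" "edges H \<subseteq> vertex_pairs (verts H)"
      unfolding copies_def subgraph_def simple_graph_def by auto
    then show "H \<in> {H. verts H \<subseteq> verts G \<and> edges H \<subseteq> vertex_pairs (verts G)}"
      unfolding vertex_pairs_def by blast
  qed
qed (rule finite_graphs[OF assms])

text \<open>An injection that preserves edges carries copies to copies, and distinct ones to
  distinct ones. It serves both for isomorphisms and for induced subgraphs.\<close>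

lemma num_copies_mono:
  fixes G :: "'b ugraph" and G' :: "'c ugraph"
  assumes inj: "inj_on f (verts G)" and fin: "finite (verts G')"
    and sub: "f ` verts G \<subseteq> verts G'" "(\<lambda>e. f ` e) ` edges G \<subseteq> edges G'"
  shows "num_copies F G \<le> num_copies F G'"
  unfolding num_copies_def
proof (rule card_inj_on_le[where f = "\<lambda>H. \<lparr>verts = f ` verts H, edges = (\<lambda>e. f ` e) ` edges H\<rparr>"])
  let ?g = "\<lambda>H. \<lparr>verts = f ` verts H, edges = (\<lambda>e. f ` e) ` edges H\<rparr>"
  have copy: "finite (verts H)" "verts H \<subseteq> verts G" "edges H \<subseteq> edges G" "edges H \<subseteq> vertex_pairs (verts H)"
    "edges H \<subseteq> Pow (verts G)" "isomorphic F H" if "H \<in> copies F G" for H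
    using that unfolding copies_def subgraph_def simple_graph_def vertex_pairs_def by auto
  have inj': "inj_on (image f) (Pow (verts G))" using inj by (rule inj_on_image_Pow)
  show "inj_on ?g (copies F G)"
  proof (rule inj_onI)
    fix H K assume HK: "H \<in> copies F G" "K \<in> copies F G" and "?g H = ?g K"
    then have eq: "f ` verts H = f ` verts K" "image f ` edges H = image f ` edges K" by auto
    have "verts H = verts K" using eq(1) inj_on_image_eq_iff[OF inj copy(2)[OF HK(1)] copy(2)[OF HK(2)]] by simp
    moreover have "edges H = edges K" using eq(2) inj_on_image_eq_iff[OF inj' copy(5)[OF HK(1)] copy(5)[OF HK(2)]] by simp
    ultimately show "H = K" by simp
  qed
  show "?g ` copies F G \<subseteq> copies F G'"
  proof (intro image_subsetI)
    fix H assume H: "H \<in> copies F G"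
    note c = copy[OF H]
    have injH: "inj_on f (verts H)" using inj c(2) by (rule inj_on_subset)
    have "simple_graph (?g H)"
      unfolding simple_graph_def
    proof (intro conjI subsetI)
      fix e' assume "e' \<in> edges (?g H)"
      then obtain e where e: "e \<in> edges H" "e' = f ` e" by auto
      then have "e \<subseteq> verts H" "card e = 2" using c(4) unfolding vertex_pairs_def by auto
      moreover from this have "card (f ` e) = card e"
        using inj_on_subset[OF injH] by (intro card_image) blast
      ultimately show "e' \<in> vertex_pairs (verts (?g H))" using e unfolding vertex_pairs_def by auto
    qed (use c(1) in simp)
    moreover have "subgraph (?g H) G'" using sub c(2,3) unfolding subgraph_def ugraph.simps by blast
    moreover have "isomorphic F (?g H)"
    proof -
      obtain g where g: "bij_betw g (verts F) (verts H)" "edges H = image g ` edges F"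
        using c(6) unfolding isomorphic_def by blast
      have "bij_betw (f \<circ> g) (verts F) (f ` verts H)"
        using g(1) injH by (intro bij_betw_trans[OF g(1)]) (simp add: inj_on_imp_bij_betw)
      moreover have "image f ` edges H = image (f \<circ> g) ` edges F"
        unfolding g(2) by (simp add: image_image image_comp)
      ultimately show ?thesis unfolding isomorphic_def by (intro exI[of _ "f \<circ> g"]) simp
    qed
    ultimately show "?g H \<in> copies F G'" unfolding copies_def by blast
  qed
qed (rule finite_copies[OF fin])

lemma num_copies_bij:
  assumes f: "bij_betw f (verts G) (verts G')" and e: "edges G' = (\<lambda>e. f ` e) ` edges G"
    and G: "simple_graph G"
  shows "num_copies F G = num_copies F G'"
proof (rule antisym)
  have fin: "finite (verts G)" "finite (verts G')"
    using G f bij_betw_finite unfolding simple_graph_def by auto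
  show "num_copies F G \<le> num_copies F G'"
    using f e fin by (intro num_copies_mono[where f = f]) (auto simp: bij_betw_def)
  let ?g = "inv_into (verts G) f"
  have "?g ` f ` e' = e'" if "e' \<in> edges G" for e'
    using that G f unfolding simple_graph_def vertex_pairs_def bij_betw_def
    by (intro inv_into_image_cancel) auto
  then show "num_copies F G' \<le> num_copies F G"
    using bij_betw_inv_into[OF f] fin
    by (intro num_copies_mono[where f = ?g]) (auto simp: bij_betw_def e)
qed

text \<open>Its copies of \<open>F\<close> are the potential copies in any graph on
  \<open>U\<close>, a fixed index set for sums of indicators.\<close>

definition complete_graph :: "'a set \<Rightarrow> 'a ugraph" where
  "complete_graph U = \<lparr>verts = U, edges = vertex_pairs U\<rparr>"

text \<open>Each copy is the image of \<open>F\<close> under a map into \<open>U\<close>.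
  Restricting the map to \<open>verts F\<close> places it in the finite extensional function space;
  several maps may give the same copy, which only helps.\<close>

lemma card_copies_complete_graph_le:
  assumes F: "finite (verts F)" "edges F \<subseteq> vertex_pairs (verts F)" and U: "finite U"
  shows "card (copies F (complete_graph U)) \<le> card U ^ card (verts F)"
proof -
  let ?g = "\<lambda>f. \<lparr>verts = f ` verts F, edges = (\<lambda>e. f ` e) ` edges F\<rparr>"
  have "copies F (complete_graph U) \<subseteq> ?g ` (verts F \<rightarrow>\<^sub>E U)"
  proof
    fix H assume "H \<in> copies F (complete_graph U)"
    then obtain f where f: "bij_betw f (verts F) (verts H)" "edges H = image f ` edges F" "verts H \<subseteq> U"
      unfolding copies_def complete_graph_def subgraph_def isomorphic_def by auto
    let ?r = "restrict f (verts F)"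
    have e: "?r ` e = f ` e" if "e \<in> edges F" for e
      using that F(2) unfolding vertex_pairs_def by (intro image_cong) auto
    have "?r ` verts F = f ` verts F" by (intro image_cong) auto
    moreover have "image ?r ` edges F = image f ` edges F" by (rule image_cong[OF refl e])
    ultimately have "H = ?g ?r" using f(1,2) by (cases H) (simp add: bij_betw_def)
    moreover have "?r \<in> verts F \<rightarrow>\<^sub>E U" using f unfolding bij_betw_def by auto
    ultimately show "H \<in> ?g ` (verts F \<rightarrow>\<^sub>E U)" by blast
  qed
  then have "card (copies F (complete_graph U)) \<le> card (?g ` (verts F \<rightarrow>\<^sub>E U))"
    using F(1) U by (intro card_mono finite_imageI finite_PiE) auto
  also have "\<dots> \<le> card (verts F \<rightarrow>\<^sub>E U)" by (intro card_image_le finite_PiE F U)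
  finally show ?thesis using F(1) by (simp add: card_PiE)
qed

text \<open>As the edges of \<open>F\<close> cover its vertices, containment of the edges of a
  potential copy implies containment of its vertices, so an indicator on edge sets alone does the
  counting.\<close>

lemma num_copies_eq_sum:
  assumes F: "verts F = \<Union>(edges F)"
    and G: "verts G \<subseteq> U" "edges G \<subseteq> vertex_pairs (verts G)" and U: "finite U"
  shows "real (num_copies F G) = (\<Sum>H\<in>copies F (complete_graph U). of_bool (edges H \<subseteq> edges G))"
proof -
  let ?K = "copies F (complete_graph U)"
  have "copies F G = {H \<in> ?K. edges H \<subseteq> edges G}"
  proof (intro set_eqI iffI)
    fix H assume H: "H \<in> copies F G"
    then have "edges H \<subseteq> vertex_pairs U" "verts H \<subseteq> U"
      using G unfolding copies_def subgraph_def vertex_pairs_def by auto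
    with H show "H \<in> {H \<in> ?K. edges H \<subseteq> edges G}"
      unfolding copies_def complete_graph_def subgraph_def by simp
  next
    fix H assume H: "H \<in> {H \<in> ?K. edges H \<subseteq> edges G}"
    then obtain f where "bij_betw f (verts F) (verts H)" "edges H = image f ` edges F"
      unfolding copies_def isomorphic_def by blast
    then have "verts H = \<Union>(edges H)" unfolding bij_betw_def F by (metis image_Union)
    then have "verts H \<subseteq> verts G" using H G(2) unfolding vertex_pairs_def by auto
    with H show "H \<in> copies F G" unfolding copies_def subgraph_def by simp
  qed
  moreover have "finite ?K" using U by (intro finite_copies) (simp add: complete_graph_def)
  ultimately show ?thesis
    unfolding num_copies_def by (simp add: of_bool_def sum.If_cases Collect_conj_eq)
qed

text \<open>The colouring is pulled back along the isomorphism, which preserves both the sizes and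
  the spans of the colour classes.\<close>

lemma copy_colouring_rank:
  assumes F: "simple_graph F" "two_connected F" "card (verts F) \<ge> 3"
    and H: "isomorphic F H"
    and e: "e\<^sub>1 \<in> edges H" "e\<^sub>2 \<in> edges H" "c e\<^sub>1 \<noteq> c e\<^sub>2"
  shows "card (verts F) \<le> (\<Sum>j\<in>c ` edges H. min (card {e \<in> edges H. c e = j})
    (card (\<Union>{e \<in> edges H. c e = j}) - 1))"
proof -
  obtain f where f: "bij_betw f (verts F) (verts H)" "edges H = image f ` edges F"
    using H unfolding isomorphic_def by blast
  have inj: "inj_on f (verts F)" using f(1) unfolding bij_betw_def by blast
  have sub: "edges F \<subseteq> Pow (verts F)" using F(1) unfolding simple_graph_def vertex_pairs_def by auto
  have inj': "inj_on (image f) (edges F)" using inj_on_subset[OF inj_on_image_Pow[OF inj] sub] .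
  let ?c = "\<lambda>e. c (f ` e)"
  obtain e1 e2 where "e1 \<in> edges F" "e2 \<in> edges F" "?c e1 \<noteq> ?c e2" using e f(2) by auto
  from two_connected_colouring_rank[OF F this]
  have "card (verts F) \<le> (\<Sum>j\<in>?c ` edges F. min (card {e \<in> edges F. ?c e = j})
    (card (\<Union>{e \<in> edges F. ?c e = j}) - 1))" .
  also have "\<dots> = (\<Sum>j\<in>c ` edges H. min (card {e \<in> edges H. c e = j})
    (card (\<Union>{e \<in> edges H. c e = j}) - 1))"
  proof (rule sum.cong)
    show "?c ` edges F = c ` edges H" unfolding f(2) by (simp add: image_image)
    fix j
    let ?A = "{e \<in> edges F. ?c e = j}" and ?B = "{e \<in> edges H. c e = j}"
    have B: "?B = image f ` ?A" unfolding f(2) by auto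
    have "card ?B = card ?A" unfolding B by (intro card_image inj_on_subset[OF inj']) auto
    moreover have "card (\<Union>?B) = card (\<Union>?A)"
    proof -
      have "\<Union>?B = f ` \<Union>?A" unfolding B by auto
      moreover have "inj_on f (\<Union>?A)" using sub by (intro inj_on_subset[OF inj]) auto
      ultimately show ?thesis by (simp add: card_image)
    qed
    ultimately show "min (card ?A) (card (\<Union>?A) - 1) = min (card ?B) (card (\<Union>?B) - 1)" by simp
  qed
  finally show ?thesis .
qed

text \<open>Non-edges are sent to the empty set, which is never an edge, as the
  reindexing lemma for product PMFs demands.\<close>
lemma map_num_copies_bernoulli_graph:
  assumes fin: "finite V" "finite W" and card: "card V = card W"
  shows "map_pmf (num_copies F) (bernoulli_graph V p) = map_pmf (num_copies F) (bernoulli_graph W p)"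
proof -
  obtain f where f: "bij_betw f V W" using finite_same_card_bij[OF fin card] by blast
  then have inj: "inj_on f V" and fV: "f ` V = W" unfolding bij_betw_def by auto
  define h where "h e = (if e \<in> vertex_pairs V then f ` e else {})" for e
  have card_f: "card (f ` e) = card e" if "e \<subseteq> V" for e
    using inj_on_subset[OF inj that] by (rule card_image)
  have img: "image f ` vertex_pairs V = vertex_pairs W"
  proof (intro equalityI subsetI)
    fix e assume "e \<in> image f ` vertex_pairs V"
    then show "e \<in> vertex_pairs W" using card_f fV unfolding vertex_pairs_def by auto
  next
    fix e assume "e \<in> vertex_pairs W"
    then have e: "e \<subseteq> f ` V" "card e = 2" using fV unfolding vertex_pairs_def by auto
    then obtain e' where "e' \<subseteq> V" "e = f ` e'" by (meson subset_imageE)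
    then show "e \<in> image f ` vertex_pairs V" using e card_f unfolding vertex_pairs_def by auto
  qed
  have "inj_on (image f) (vertex_pairs V)"
    by (rule inj_on_subset[OF inj_on_image_Pow[OF inj]]) (auto simp: vertex_pairs_def)
  then have "bij_betw h (vertex_pairs V) (vertex_pairs W)"
    unfolding img[symmetric] by (simp add: bij_betw_def h_def inj_on_def)
  moreover have "h e \<notin> vertex_pairs W" if "e \<notin> vertex_pairs V" for e
  proof -
    have "h e = {}" using that by (simp add: h_def)
    then show ?thesis by (simp add: vertex_pairs_def)
  qed
  ultimately have "Pi_pmf (vertex_pairs V) False (\<lambda>_. bernoulli_pmf p) =
    map_pmf (\<lambda>g. g \<circ> h) (Pi_pmf (vertex_pairs W) False (\<lambda>_. bernoulli_pmf p))"
    by (intro Pi_pmf_bij_betw finite_vertex_pairs fin)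
  moreover have "num_copies F \<lparr>verts = V, edges = {e \<in> vertex_pairs V. b (h e)}\<rparr> =
    num_copies F \<lparr>verts = W, edges = {e \<in> vertex_pairs W. b e}\<rparr>" for b
  proof (rule num_copies_bij[where f = f])
    show "edges \<lparr>verts = W, edges = {e \<in> vertex_pairs W. b e}\<rparr>
      = image f ` edges \<lparr>verts = V, edges = {e \<in> vertex_pairs V. b (h e)}\<rparr>"
      unfolding img[symmetric] by (auto simp: h_def)
  qed (use f fin in \<open>auto simp: simple_graph_def\<close>)
  ultimately show ?thesis
    unfolding bernoulli_graph_def pmf.map_comp by (simp add: pmf.map_comp o_def)
qed

text \<open>Restricting a single sample of \<open>G(X, Q)\<close> to \<open>{1..n}\<close> couples
  the layer counts for all \<open>n\<close> on one probability space, as needed for dominated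
  convergence.\<close>

definition induced :: "'a set \<Rightarrow> 'a ugraph \<Rightarrow> 'a ugraph" where
  "induced U G = \<lparr>verts = verts G \<inter> U, edges = edges G \<inter> vertex_pairs U\<rparr>"

lemma induced_bernoulli_graph:
  assumes "finite V"
  shows "map_pmf (induced U) (bernoulli_graph V p) = bernoulli_graph (V \<inter> U) p"
proof -
  let ?P = "\<lambda>V. Pi_pmf (vertex_pairs V) False (\<lambda>_. bernoulli_pmf p)"
  have sub: "vertex_pairs (V \<inter> U) \<subseteq> vertex_pairs V" "vertex_pairs (V \<inter> U) = vertex_pairs V \<inter> vertex_pairs U"
    unfolding vertex_pairs_def by auto
  have "?P (V \<inter> U) = map_pmf (\<lambda>f x. if x \<in> vertex_pairs (V \<inter> U) then f x else False) (?P V)"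
    by (rule Pi_pmf_subset[OF finite_vertex_pairs[OF assms] sub(1)])
  then show ?thesis
    unfolding bernoulli_graph_def by (auto simp: pmf.map_comp o_def induced_def sub(2) intro!: map_pmf_cong)
qed

text \<open>The law of the count depends on the vertex set only through its size. Every admissible
  \<open>V\<close> has as many elements as \<open>{1..x} \<inter> {1..n}\<close>, so the random
  choice of \<open>V\<close> averages out.\<close>

lemma map_num_copies_layer:
  "map_pmf (num_copies F) (layer n x p) = map_pmf (\<lambda>G. num_copies F (induced {1..n} G)) (bernoulli_graph {1..x} p)"
proof -
  let ?S = "{V. V \<subseteq> {1..n} \<and> card V = min x n}"
  have "map_pmf (num_copies F) (layer n x p)
    = bind_pmf (pmf_of_set ?S) (\<lambda>V. map_pmf (num_copies F) (bernoulli_graph V p))"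
    unfolding layer_def map_bind_pmf ..
  also have "\<dots> = bind_pmf (pmf_of_set ?S) (\<lambda>_. map_pmf (num_copies F) (bernoulli_graph ({1..x} \<inter> {1..n}) p))"
  proof (rule bind_pmf_cong[OF refl])
    fix V assume "V \<in> set_pmf (pmf_of_set ?S)"
    then have "V \<subseteq> {1..n}" "card V = min x n"
      unfolding set_pmf_of_set[OF subset_layers_nonempty(2,1)] by auto
    then show "map_pmf (num_copies F) (bernoulli_graph V p)
      = map_pmf (num_copies F) (bernoulli_graph ({1..x} \<inter> {1..n}) p)"
      by (intro map_num_copies_bernoulli_graph) (auto intro: finite_subset)
  qed
  also have "\<dots> = map_pmf (num_copies F) (bernoulli_graph ({1..x} \<inter> {1..n}) p)"
    by simp
  finally show ?thesis
    by (simp only: induced_bernoulli_graph[OF finite_atLeastAtMost, symmetric] pmf.map_comp o_def)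
qed

lemma num_copies_induced_le:
  assumes "finite (verts G)"
  shows "num_copies F (induced U G) \<le> num_copies F G"
  using assms by (intro num_copies_mono[where f = "\<lambda>x. x"]) (auto simp: induced_def)

lemma induced_superset:
  assumes "verts G \<subseteq> U" "edges G \<subseteq> vertex_pairs (verts G)"
  shows "induced U G = G"
proof -
  have "edges G \<subseteq> vertex_pairs U" using assms unfolding vertex_pairs_def by blast
  then show ?thesis using assms(1) unfolding induced_def by (cases G) auto
qed

section \<open>Mixtures as probability mass functions\<close>

text \<open>The points of \<open>S\<close> with mass zero are countably many null sets, so almost
  every point has positive mass, which is the defining property of a PMF.\<close>

lemma prob_space_eq_measure_pmf:
  assumes N: "prob_space N" "sets N = UNIV" and S: "countable S" "AE x in N. x \<in> S"
  obtains q where "N = measure_pmf q"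
proof -
  interpret prob_space N by (rule N)
  have sp: "space N = UNIV" using N(2) sets_eq_imp_space_eq[of N "count_space UNIV"] by simp
  have "AE x in N. \<forall>y\<in>S. measure N {y} = 0 \<longrightarrow> x \<noteq> y"
  proof (subst AE_ball_countable[OF S(1)], intro ballI)
    fix y assume "y \<in> S"
    show "AE x in N. measure N {y} = 0 \<longrightarrow> x \<noteq> y"
    proof (cases "measure N {y} = 0")
      case True
      then have "{y} \<in> null_sets N" by (auto simp: null_sets_def emeasure_eq_measure N(2))
      then have "AE x in N. x \<notin> {y}" by (rule AE_not_in)
      then show ?thesis by simp
    qed simp
  qed
  with S(2) have "AE x in N. measure N {x} \<noteq> 0" by eventually_elim auto
  then have "N = measure_pmf (Abs_pmf N)" using N by (subst Abs_pmf_inverse) auto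
  then show thesis by (rule that)
qed

text \<open>The weights may have a continuous law, but the mixture lives on a countable set. This
  makes the PMF calculus available once the weights are integrated out.\<close>

lemma prob_space_bind_measure_pmf:
  assumes P: "prob_space P" and k: "(\<lambda>w. measure_pmf (k w)) \<in> P \<rightarrow>\<^sub>M prob_algebra (count_space UNIV)"
    and S: "countable S" "\<And>w. w \<in> space P \<Longrightarrow> set_pmf (k w) \<subseteq> S"
  obtains q where "P \<bind> (\<lambda>w. measure_pmf (k w)) = measure_pmf q"
    and "\<And>A. measure_pmf.prob q A = (\<integral>w. measure_pmf.prob (k w) A \<partial>P)"
proof -
  interpret prob_space P by (rule P)
  let ?N = "P \<bind> (\<lambda>w. measure_pmf (k w))"
  have Psp: "P \<in> space (prob_algebra P)" using P by (simp add: space_prob_algebra)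
  have k': "(\<lambda>w. measure_pmf (k w)) \<in> P \<rightarrow>\<^sub>M subprob_algebra (count_space UNIV)"
    using k by (rule measurable_prob_algebraD)
  have N: "prob_space ?N" "sets ?N = UNIV"
    using prob_space_bind'[OF Psp k] sets_bind'[OF Psp k] by auto
  have "AE x in ?N. x \<in> S"
    using S(2) by (subst AE_bind[OF k']) (auto simp: AE_measure_pmf_iff)
  from prob_space_eq_measure_pmf[OF N S(1) this] obtain q where q: "?N = measure_pmf q" .
  moreover have "measure_pmf.prob q A = (\<integral>w. measure_pmf.prob (k w) A \<partial>P)" for A
  proof -
    have "emeasure (measure_pmf q) A = (\<integral>\<^sup>+w. emeasure (measure_pmf (k w)) A \<partial>P)"
      unfolding q[symmetric] using not_empty by (intro emeasure_bind[OF _ k']) auto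
    also have "\<dots> = (\<integral>\<^sup>+w. ennreal (measure_pmf.prob (k w) A) \<partial>P)"
      by (simp add: measure_pmf.emeasure_eq_measure)
    also have "\<dots> = ennreal (\<integral>w. measure_pmf.prob (k w) A \<partial>P)"
    proof (rule nn_integral_eq_integral)
      have "(\<lambda>w. emeasure (measure_pmf (k w)) A) \<in> borel_measurable P"
        by (rule measurable_compose[OF k' measurable_emeasure_subprob_algebra]) simp
      then have "(\<lambda>w. measure_pmf.prob (k w) A) \<in> borel_measurable P"
        unfolding measure_def by measurable
      then show "integrable P (\<lambda>w. measure_pmf.prob (k w) A)"
        by (intro integrable_const_bound[where B = 1]) auto
    qed simp
    finally show ?thesis
      by (simp add: measure_pmf.emeasure_eq_measure integral_nonneg_AE)
  qed
  ultimately show thesis by (rule that)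
qed

text \<open>This provides the countable support for \<open>G(X, Q)\<close>, whose number of vertices
  is unbounded.\<close>

lemma countable_finite_nat_graphs: "countable {G :: nat ugraph. finite (verts G) \<and> edges G \<subseteq> vertex_pairs (verts G)}"
proof (rule countable_subset)
  show "countable (\<Union>x. {G :: nat ugraph. verts G \<subseteq> {1..x} \<union> {0} \<and> edges G \<subseteq> vertex_pairs ({1..x} \<union> {0})})"
    by (rule countable_UN[OF countableI_type countable_finite[OF finite_graphs]]) simp
  show "{G :: nat ugraph. finite (verts G) \<and> edges G \<subseteq> vertex_pairs (verts G)} \<subseteq>
    (\<Union>x. {G :: nat ugraph. verts G \<subseteq> {1..x} \<union> {0} \<and> edges G \<subseteq> vertex_pairs ({1..x} \<union> {0})})"
  proof
    fix G :: "nat ugraph" assume G: "G \<in> {G. finite (verts G) \<and> edges G \<subseteq> vertex_pairs (verts G)}"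
    then obtain x where "verts G \<subseteq> {..x}" using finite_nat_iff_bounded_le by auto
    then have V: "verts G \<subseteq> {1..x} \<union> {0}" by (auto simp: Suc_le_eq)
    then have "vertex_pairs (verts G) \<subseteq> vertex_pairs ({1..x} \<union> {0})" unfolding vertex_pairs_def by auto
    then have "edges G \<subseteq> vertex_pairs ({1..x} \<union> {0})" using G by blast
    with V show "G \<in> (\<Union>x. {G. verts G \<subseteq> {1..x} \<union> {0} \<and> edges G \<subseteq> vertex_pairs ({1..x} \<union> {0})})"
      by (intro UN_I[of x] CollectI conjI UNIV_I)
  qed
qed

lemma PiE_dflt_mono:
  assumes "\<And>x. x \<in> A \<Longrightarrow> B x \<subseteq> C x"
  shows "PiE_dflt A d B \<subseteq> PiE_dflt A d C"
  unfolding PiE_dflt_def using assms by blast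

context
  fixes P :: "(nat \<times> real) measure"
  assumes P: "prob_space P" "sets P = sets (count_space UNIV \<Otimes>\<^sub>M borel)"
begin

lemma mixed_bernoulli_graph_pmf:
  obtains \<beta> where "mixed_bernoulli_graph P = measure_pmf \<beta>"
    and "\<And>A. measure_pmf.prob \<beta> A = (\<integral>z. measure_pmf.prob (bernoulli_graph {1..fst z} (snd z)) A \<partial>P)"
proof -
  let ?k = "\<lambda>z. bernoulli_graph {1..fst z} (snd z)"
  let ?S = "{G :: nat ugraph. finite (verts G) \<and> edges G \<subseteq> vertex_pairs (verts G)}"
  have k: "(\<lambda>z. measure_pmf (?k z)) \<in> P \<rightarrow>\<^sub>M prob_algebra (count_space UNIV)"
    using measurable_mixed_kernel by (simp add: case_prod_beta measurable_cong_sets[OF P(2) refl])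
  show thesis
  proof (rule prob_space_bind_measure_pmf[OF P(1) k countable_finite_nat_graphs])
    show "set_pmf (?k z) \<subseteq> ?S" for z
    proof
      fix G assume "G \<in> set_pmf (?k z)"
      then have "verts G = {1..fst z} \<and> edges G \<subseteq> vertex_pairs {1..fst z}"
        using bernoulli_graph_support[of "{1..fst z}" "snd z"] by blast
      then show "G \<in> ?S" by (metis (mono_tags) finite_atLeastAtMost mem_Collect_eq)
    qed
  next
    fix q
    assume q: "P \<bind> (\<lambda>w. measure_pmf (?k w)) = measure_pmf q"
      "\<And>A. measure_pmf.prob q A = (\<integral>w. measure_pmf.prob (?k w) A \<partial>P)"
    have "mixed_bernoulli_graph P = measure_pmf q"
      using q(1) by (simp add: mixed_bernoulli_graph_def case_prod_beta')
    then show thesis using that q(2) by blast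
  qed
qed

lemma measurable_layer_prob: "(\<lambda>z. measure_pmf.prob (layer n (fst z) (snd z)) A) \<in> borel_measurable P"
    (is ?th1)
  and measurable_layer: "(\<lambda>z. measure_pmf (layer n (fst z) (snd z))) \<in> P \<rightarrow>\<^sub>M prob_algebra (count_space UNIV)"
    (is ?th2)
proof -
  have "(\<lambda>(x, p). pmf (layer n x p) G) \<in> borel_measurable (count_space UNIV \<Otimes>\<^sub>M borel)" for G
    by (rule measurable_pair_measure_countable1) (simp_all add: measurable_pmf_layer)
  then have meas: "(\<lambda>z. pmf (layer n (fst z) (snd z)) G) \<in> borel_measurable P" for G
    by (simp add: case_prod_beta measurable_cong_sets[OF P(2) refl])
  show ?th1 ?th2
    by (rule measurable_pmf_kernel[OF finite_graphs[of "{1..n}"] layer_support meas]; simp)+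
qed

text \<open>The weights of different layers are independent, so integrating them out leaves layers
  that are independent with the common law \<open>\<kappa>\<close>. The union graph is then a
  function of an i.i.d. family.\<close>

lemma mixed_layer_pmf:
  obtains \<kappa> where "set_pmf \<kappa> \<subseteq> {G. verts G \<subseteq> {1..n} \<and> edges G \<subseteq> vertex_pairs (verts G)}"
    and "\<And>A. measure_pmf.prob \<kappa> A = (\<integral>z. measure_pmf.prob (layer n (fst z) (snd z)) A \<partial>P)"
    and "layered_graph P n m = measure_pmf (map_pmf (union_layers n m)
           (Pi_pmf {1..m} \<lparr>verts = {}, edges = {}\<rparr> (\<lambda>_. \<kappa>)))"
proof -
  let ?S = "{G :: nat ugraph. verts G \<subseteq> {1..n} \<and> edges G \<subseteq> vertex_pairs {1..n}}"
  let ?T = "{G :: nat ugraph. verts G \<subseteq> {1..n} \<and> edges G \<subseteq> vertex_pairs (verts G)}"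
  let ?d = "\<lparr>verts = {}, edges = {}\<rparr> :: nat ugraph"
  let ?k = "\<lambda>z. layer n (fst z) (snd z)"
  interpret P: prob_space P by (rule P)
  have finS: "finite ?S" by (rule finite_graphs) simp
  obtain \<kappa> where "P \<bind> (\<lambda>w. measure_pmf (?k w)) = measure_pmf \<kappa>"
    and \<kappa>: "\<And>A. measure_pmf.prob \<kappa> A = (\<integral>w. measure_pmf.prob (?k w) A \<partial>P)"
    by (rule prob_space_bind_measure_pmf[OF P(1) measurable_layer countable_finite[OF finS] layer_support]) blast
  have layerT: "set_pmf (layer n x p) \<subseteq> ?T" for x p
  proof
    fix G assume "G \<in> set_pmf (layer n x p)"
    then obtain V where V: "V \<subseteq> {1..n}" "G \<in> set_pmf (bernoulli_graph V p)"
      unfolding layer_def set_bind_pmf set_pmf_of_set[OF subset_layers_nonempty(2,1)] by blast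
    then have "verts G = V \<and> edges G \<subseteq> vertex_pairs V"
      using bernoulli_graph_support[of V p] finite_subset by blast
    with V(1) show "G \<in> ?T" by auto
  qed
  have 1: "set_pmf \<kappa> \<subseteq> ?T"
  proof -
    have "measure_pmf.prob (?k z) (- ?T) = 0" for z
      using layerT[of "fst z" "snd z"] by (subst measure_pmf_zero_iff) auto
    then have "measure_pmf.prob \<kappa> (- ?T) = 0" by (simp add: \<kappa>)
    then show ?thesis by (subst (asm) measure_pmf_zero_iff) auto
  qed
  let ?N = "\<Pi>\<^sub>M i\<in>{1..m}. P"
  interpret N: product_sigma_finite "\<lambda>_::nat. P" by (simp add: product_sigma_finite_def P.sigma_finite_measure_axioms)
  let ?D = "PiE_dflt {1..m} ?d (\<lambda>_. ?S)"
  have finD: "finite ?D" by (intro finite_PiE_dflt) (auto simp: finite_graphs)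
  have N: "prob_space ?N" by (intro prob_space_PiM P)
  have supp: "set_pmf (layered_graph_given n m w) \<subseteq> union_layers n m ` ?D" for w
    unfolding layered_graph_given_def set_map_pmf
  proof (rule image_mono)
    show "set_pmf (Pi_pmf {1..m} ?d (\<lambda>i. ?k (w i))) \<subseteq> ?D"
      unfolding set_Pi_pmf[OF finite_atLeastAtMost] o_def by (rule PiE_dflt_mono[OF layer_support])
  qed
  obtain q where q: "layered_graph P n m = measure_pmf q"
    "\<And>A. measure_pmf.prob q A = (\<integral>w. measure_pmf.prob (layered_graph_given n m w) A \<partial>?N)"
    unfolding layered_graph_def
    by (rule prob_space_bind_measure_pmf[OF N measurable_layered_kernel[OF P(2)]
        countable_finite[OF finite_imageI[OF finD]] supp]) blast
  \<comment> \<open>A finite sum of products over the layers: the integral over the product measure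
    can pass through the sum and then factorise.\<close>
  have eq: "measure_pmf.prob (Pi_pmf {1..m} ?d p) A = (\<Sum>L\<in>?D \<inter> A. \<Prod>i=1..m. pmf (p i) (L i))"
    if "\<And>i. set_pmf (p i) \<subseteq> ?S" for p A
  proof -
    have sub: "set_pmf (Pi_pmf {1..m} ?d p) \<subseteq> ?D"
      unfolding set_Pi_pmf[OF finite_atLeastAtMost] o_def by (rule PiE_dflt_mono[OF that])
    have "measure_pmf.prob (Pi_pmf {1..m} ?d p) A = measure_pmf.prob (Pi_pmf {1..m} ?d p) (?D \<inter> A)"
      using sub by (intro measure_prob_cong_0) (auto simp: set_pmf_eq)
    also have "\<dots> = (\<Sum>L\<in>?D \<inter> A. pmf (Pi_pmf {1..m} ?d p) L)"
      using finD by (subst measure_measure_pmf_finite) auto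
    also have "\<dots> = (\<Sum>L\<in>?D \<inter> A. \<Prod>i=1..m. pmf (p i) (L i))"
      by (intro sum.cong refl pmf_Pi') (auto simp: PiE_dflt_def)
    finally show ?thesis .
  qed
  have int: "integrable P (\<lambda>z. pmf (?k z) G)" for G
    using measurable_layer_prob[of n "{G}"]
    by (intro P.integrable_const_bound[where B = 1]) (auto simp: pmf_le_1 measure_pmf_single)
  have "q = map_pmf (union_layers n m) (Pi_pmf {1..m} ?d (\<lambda>_. \<kappa>))"
  proof (rule pmf_eqI)
    fix G
    let ?A = "?D \<inter> union_layers n m -` {G}"
    have "pmf q G = (\<integral>w. measure_pmf.prob (layered_graph_given n m w) {G} \<partial>?N)"
      using q(2)[of "{G}"] by (simp add: measure_pmf_single)
    also have "\<dots> = (\<integral>w. (\<Sum>L\<in>?A. \<Prod>i=1..m. pmf (?k (w i)) (L i)) \<partial>?N)"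
      unfolding layered_graph_given_def measure_map_pmf by (subst eq[OF layer_support]) simp
    also have "\<dots> = (\<Sum>L\<in>?A. \<integral>w. (\<Prod>i=1..m. pmf (?k (w i)) (L i)) \<partial>?N)"
      by (rule Bochner_Integration.integral_sum) (rule N.product_integrable_prod; simp add: int)
    also have "\<dots> = (\<Sum>L\<in>?A. \<Prod>i=1..m. \<integral>z. pmf (?k z) (L i) \<partial>P)"
      by (intro sum.cong refl N.product_integral_prod) (simp_all add: int)
    also have "\<dots> = (\<Sum>L\<in>?A. \<Prod>i=1..m. pmf \<kappa> (L i))"
      using \<kappa>[of "{G}" for G] by (simp add: measure_pmf_single)
    also have "\<dots> = pmf (map_pmf (union_layers n m) (Pi_pmf {1..m} ?d (\<lambda>_. \<kappa>))) G"
    proof -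
      have "set_pmf \<kappa> \<subseteq> ?S" using 1 by (fastforce simp: vertex_pairs_def)
      then show ?thesis unfolding pmf_map by (subst eq) simp_all
    qed
    finally show "pmf q G = pmf (map_pmf (union_layers n m) (Pi_pmf {1..m} ?d (\<lambda>_. \<kappa>))) G" .
  qed
  with q(1) have "layered_graph P n m = measure_pmf (map_pmf (union_layers n m)
           (Pi_pmf {1..m} ?d (\<lambda>_. \<kappa>)))" by simp
  with 1 \<kappa> show thesis by (rule that)
qed

end

section \<open>Containment probabilities in one layer\<close>

text \<open>The pairs in \<open>A\<close> are present independently if \<open>V\<close> contains
  their endpoints, and otherwise the event is impossible. The indicator is kept for the later
  average over \<open>V\<close>.\<close>

lemma prob_bernoulli_graph_superset_le:
  assumes V: "finite V" and p: "0 \<le> p" "p \<le> 1"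
  shows "measure_pmf.prob (bernoulli_graph V p) {G. A \<subseteq> edges G} \<le> p ^ card A * indicator (Pow V) (\<Union>A)"
proof (cases "A \<subseteq> vertex_pairs V")
  case True
  define B where "B e = (if e \<in> A then {True} else UNIV)" for e
  have fin: "finite (vertex_pairs V)" using V by (rule finite_vertex_pairs)
  have "measure_pmf.prob (bernoulli_graph V p) {G. A \<subseteq> edges G} =
    measure_pmf.prob (Pi_pmf (vertex_pairs V) False (\<lambda>_. bernoulli_pmf p)) (Pi (vertex_pairs V) B)"
    unfolding bernoulli_graph_def measure_map_pmf
    using True by (intro arg_cong2[where f = measure] refl) (auto simp: B_def Pi_def split: if_splits)
  also have "\<dots> = (\<Prod>e\<in>vertex_pairs V. measure_pmf.prob (bernoulli_pmf p) (B e))"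
    by (rule measure_Pi_pmf_Pi[OF fin])
  also have "\<dots> = (\<Prod>e\<in>vertex_pairs V. if e \<in> A then p else 1)"
    using p by (intro prod.cong) (auto simp: B_def measure_pmf_single)
  also have "\<dots> = p ^ card A"
    using fin True by (simp add: prod.If_cases Int_absorb1)
  finally show ?thesis using True by (simp add: indicator_def vertex_pairs_def) blast
next
  case False
  have "measure_pmf.prob (bernoulli_graph V p) {G. A \<subseteq> edges G} = 0"
    using False bernoulli_graph_support[OF V, of p] by (subst measure_pmf_zero_iff) blast
  then show ?thesis using p by simp
qed

text \<open>This is the integer form of the bound \<open>(k / n) ^ w\<close> for the probability
  that a uniform \<open>k\<close>-subset of an \<open>n\<close>-set contains a given
  \<open>w\<close>-set. Each induction step adds a factor
  \<open>(k - w) / (n - w) \<le> k / n\<close>.\<close>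

lemma binomial_diff_le:
  assumes "w \<le> k" "k \<le> n"
  shows "((n - w) choose (k - w)) * n ^ w \<le> (n choose k) * k ^ w"
  using assms
proof (induction w)
  case (Suc w)
  let ?N = "n - Suc w" and ?K = "k - Suc w"
  have N: "n - w = Suc ?N" "k - w = Suc ?K" using Suc.prems by auto
  have eq: "((n - w) choose (k - w)) * (k - w) = (n - w) * (?N choose ?K)"
    unfolding N by (subst mult.commute) (rule Suc_times_binomial)
  have le: "(k - w) * n \<le> (n - w) * k"
    unfolding diff_mult_distrib mult.commute[of n k] by (intro diff_le_mono2 mult_le_mono2 Suc.prems)
  have "(n - w) * ((?N choose ?K) * n ^ Suc w) = ((n - w) choose (k - w)) * n ^ w * ((k - w) * n)"
    using eq by (simp add: ac_simps)
  also have "\<dots> \<le> ((n choose k) * k ^ w) * ((n - w) * k)"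
    by (rule mult_le_mono[OF _ le]) (use Suc in auto)
  also have "\<dots> = (n - w) * ((n choose k) * k ^ Suc w)" by (simp add: ac_simps)
  finally show ?case using Suc.prems by (subst (asm) mult_le_cancel1) simp
qed simp

lemma card_subsets_superset_le:
  assumes W: "W \<subseteq> {1..n::nat}" and k: "k \<le> n"
  shows "card {V. V \<subseteq> {1..n} \<and> card V = k \<and> W \<subseteq> V} * n ^ card W \<le> (n choose k) * k ^ card W"
proof (cases "card W \<le> k")
  case True
  have finW: "finite W" using W finite_subset by blast
  have "card {V. V \<subseteq> {1..n} \<and> card V = k \<and> W \<subseteq> V}
    \<le> card {V. V \<subseteq> {1..n} - W \<and> card V = k - card W}"
  proof (rule card_inj_on_le[where f = "\<lambda>V. V - W"])
    show "(\<lambda>V. V - W) ` {V. V \<subseteq> {1..n} \<and> card V = k \<and> W \<subseteq> V}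
      \<subseteq> {V. V \<subseteq> {1..n} - W \<and> card V = k - card W}"
      using finW by (auto simp: card_Diff_subset)
  qed (auto simp: inj_on_def)
  also have "\<dots> = (n - card W) choose (k - card W)"
    using n_subsets[of "{1..n} - W" "k - card W"] W finW by (simp add: card_Diff_subset)
  finally show ?thesis using binomial_diff_le[OF True k] by (meson le_trans mult_le_mono1)
next
  case False
  have "{V. V \<subseteq> {1..n} \<and> card V = k \<and> W \<subseteq> V} = {}"
    using False card_mono[of _ W] finite_subset[of _ "{1..n}"] by auto
  then show ?thesis by (simp only: card.empty mult_0 le0)
qed

lemma prob_layer_superset_le:
  assumes A: "\<Union>A \<subseteq> {1..n}" and p: "0 \<le> p" "p \<le> 1" and n: "n > 0"
  shows "measure_pmf.prob (layer n x p) {G. A \<subseteq> edges G}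
    \<le> p ^ card A * (real (min x n) / real n) ^ card (\<Union>A)"
proof -
  let ?k = "min x n" and ?W = "\<Union>A"
  let ?S = "{V. V \<subseteq> {1..n} \<and> card V = ?k}"
  let ?U = "{V. ?W \<subseteq> V}"
  have "emeasure (layer n x p) {G. A \<subseteq> edges G}
    = (\<integral>\<^sup>+V. emeasure (bernoulli_graph V p) {G. A \<subseteq> edges G} \<partial>pmf_of_set ?S)"
    unfolding layer_def by simp
  also have "\<dots> \<le> (\<integral>\<^sup>+V. ennreal (p ^ card A) * indicator ?U V \<partial>pmf_of_set ?S)"
  proof (rule nn_integral_mono_AE, subst AE_measure_pmf_iff, intro ballI)
    fix V assume "V \<in> set_pmf (pmf_of_set ?S)"
    then have "V \<subseteq> {1..n}" unfolding set_pmf_of_set[OF subset_layers_nonempty(2,1)] by auto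
    then have "finite V" using finite_subset by blast
    have "emeasure (bernoulli_graph V p) {G. A \<subseteq> edges G} \<le> ennreal (p ^ card A * indicator (Pow V) ?W)"
      unfolding measure_pmf.emeasure_eq_measure
      by (intro ennreal_leI prob_bernoulli_graph_superset_le p \<open>finite V\<close>)
    also have "\<dots> = ennreal (p ^ card A) * indicator ?U V"
      using p by (simp add: indicator_def)
    finally show "emeasure (bernoulli_graph V p) {G. A \<subseteq> edges G} \<le> ennreal (p ^ card A) * indicator ?U V" .
  qed
  also have "\<dots> = ennreal (p ^ card A) * emeasure (pmf_of_set ?S) ?U"
    by (simp add: nn_integral_cmult)
  also have "\<dots> = ennreal (p ^ card A * measure_pmf.prob (pmf_of_set ?S) ?U)"
    using p by (simp add: measure_pmf.emeasure_eq_measure ennreal_mult)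
  finally have "measure_pmf.prob (layer n x p) {G. A \<subseteq> edges G}
    \<le> p ^ card A * measure_pmf.prob (pmf_of_set ?S) ?U"
    using p by (simp add: measure_pmf.emeasure_eq_measure)
  also have "measure_pmf.prob (pmf_of_set ?S) ?U \<le> (real ?k / real n) ^ card ?W"
  proof -
    have S: "card ?S = n choose ?k" using n_subsets[of "{1..n}" ?k] by simp
    have pos: "real (n choose ?k) > 0" by simp
    have "measure_pmf.prob (pmf_of_set ?S) ?U = real (card (?S \<inter> ?U)) / real (n choose ?k)"
      unfolding measure_pmf_of_set[OF subset_layers_nonempty(2,1)] S ..
    also have "\<dots> \<le> real ?k ^ card ?W / real n ^ card ?W"
    proof -
      have "?S \<inter> ?U = {V. V \<subseteq> {1..n} \<and> card V = ?k \<and> ?W \<subseteq> V}" by auto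
      then have "card (?S \<inter> ?U) * n ^ card ?W \<le> (n choose ?k) * ?k ^ card ?W"
        using card_subsets_superset_le[OF A, of ?k] by simp
      then have "real (card (?S \<inter> ?U)) * real n ^ card ?W \<le> real (n choose ?k) * real ?k ^ card ?W"
        unfolding of_nat_mult[symmetric] of_nat_power[symmetric] of_nat_le_iff .
      then show ?thesis using n pos by (simp add: field_simps)
    qed
    finally show ?thesis by (simp add: power_divide)
  qed
  finally show ?thesis using p by (simp add: mult_left_mono)
qed

text \<open>Both bases are at most 1, so the exponents may be lowered to \<open>s\<close> and
  \<open>Suc s\<close>. The bound then depends on one parameter, the one that indexes the moment
  conditions.\<close>

lemma prob_layer_superset_le_rank:
  assumes A: "A \<subseteq> vertex_pairs {1..n}" "A \<noteq> {}" and p: "0 \<le> p" "p \<le> 1" and n: "n > 0"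
    and s: "s = min (card A) (card (\<Union>A) - 1)"
  shows "measure_pmf.prob (layer n x p) {G. A \<subseteq> edges G}
    \<le> p ^ s * (real (min x n) / real n) ^ Suc s"
proof -
  have U: "\<Union>A \<subseteq> {1..n}" using A(1) unfolding vertex_pairs_def by auto
  obtain e where "e \<in> A" using A(2) by blast
  then have "e \<subseteq> \<Union>A" "card e = 2" using A(1) unfolding vertex_pairs_def by auto
  \<comment> \<open>With at least two vertices spanned, the natural subtraction in \<open>s\<close>
    is exact.\<close>
  then have "2 \<le> card (\<Union>A)" using card_mono[OF finite_subset[OF U], of e] by simp
  then have "Suc s \<le> card (\<Union>A)" "s \<le> card A" unfolding s by auto
  moreover have "real (min x n) / real n \<le> 1" using n by (simp add: divide_le_eq)
  ultimately have "p ^ card A * (real (min x n) / real n) ^ card (\<Union>A) \<le> p ^ s * (real (min x n) / real n) ^ Suc s"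
    using p by (intro mult_mono power_decreasing) auto
  with prob_layer_superset_le[OF U p n] show ?thesis by (rule order_trans)
qed

section \<open>Copies using several layers\<close>

text \<open>If no layer contains \<open>E\<close> but the union does, choosing a layer for each edge
  gives a colouring that cannot be constant. If some layers contain \<open>E\<close>, the error is
  their number minus 1, and all of them but one fixed \<open>s\<close> give distinct non-constant
  colourings.\<close>

lemma abs_covered_diff_le_card_colourings:
  fixes D :: "'i \<Rightarrow> 'e set"
  assumes I: "finite I" and E: "finite E" "e\<^sub>1 \<in> E" "e\<^sub>2 \<in> E" "e\<^sub>1 \<noteq> e\<^sub>2"
  defines "N \<equiv> {c \<in> E \<rightarrow>\<^sub>E I. (\<exists>e\<in>E. \<exists>e'\<in>E. c e \<noteq> c e') \<and> (\<forall>e\<in>E. e \<in> D (c e))}"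
  shows "\<bar>of_bool (E \<subseteq> (\<Union>i\<in>I. D i)) - (\<Sum>i\<in>I. of_bool (E \<subseteq> D i))\<bar> \<le> real (card N)"
proof -
  define S where "S = {i \<in> I. E \<subseteq> D i}"
  have finN: "finite N" unfolding N_def using finite_PiE[OF E(1), of "\<lambda>_. I"] I by auto
  have finS: "finite S" unfolding S_def using I by simp
  have sum: "(\<Sum>i\<in>I. of_bool (E \<subseteq> D i)) = real (card S)"
    using I unfolding S_def by (simp add: of_bool_def sum.If_cases Collect_conj_eq)
  show ?thesis
  proof (cases "S = {}")
    case S: True
    show ?thesis
    proof (cases "E \<subseteq> (\<Union>i\<in>I. D i)")
      case True
      then have "\<forall>e\<in>E. \<exists>i. i \<in> I \<and> e \<in> D i" by blast
      then obtain c where c: "\<forall>e\<in>E. c e \<in> I \<and> e \<in> D (c e)" by metis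
      have "\<exists>e\<in>E. \<exists>e'\<in>E. c e \<noteq> c e'"
      proof (rule ccontr)
        assume "\<not> ?thesis"
        then have const: "\<forall>e\<in>E. c e = c e\<^sub>1" using E(2) by blast
        have "e \<in> D (c e\<^sub>1)" if "e \<in> E" for e using c const that by metis
        then have "c e\<^sub>1 \<in> S" unfolding S_def using c E(2) by blast
        with S show False by simp
      qed
      with c have "restrict c E \<in> N" unfolding N_def by auto
      then have "1 \<le> card N" using finN by (metis One_nat_def Suc_leI card_gt_0_iff empty_iff)
      then show ?thesis using True sum S by simp
    qed (simp add: sum S)
  next
    case False
    then obtain s where s: "s \<in> S" by blast
    then have "E \<subseteq> (\<Union>i\<in>I. D i)" unfolding S_def by auto
    \<comment> \<open>Only \<open>e\<^sub>1\<close> is moved to layer \<open>t\<close>: the value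
      there recovers \<open>t\<close>, and the value \<open>s\<close> at \<open>e\<^sub>2\<close>
      makes the colouring non-constant.\<close>
    define f where "f t = restrict (\<lambda>e. if e = e\<^sub>1 then t else s) E" for t
    have "card (S - {s}) \<le> card N"
    proof (rule card_inj_on_le[of f])
      show "inj_on f (S - {s})"
      proof (rule inj_onI)
        fix x y assume "f x = f y"
        then have "f x e\<^sub>1 = f y e\<^sub>1" by simp
        then show "x = y" using E by (simp add: f_def)
      qed
      show "f ` (S - {s}) \<subseteq> N"
      proof (intro image_subsetI)
        fix t assume t: "t \<in> S - {s}"
        have "f t e\<^sub>1 \<noteq> f t e\<^sub>2" using t E by (simp add: f_def)
        then have "\<exists>e\<in>E. \<exists>e'\<in>E. f t e \<noteq> f t e'" using E by blast
        then show "f t \<in> N" using t s E unfolding N_def S_def by (auto simp: f_def)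
      qed
    qed (rule finN)
    moreover have "card (S - {s}) = card S - 1" "card S \<ge> 1"
      using s finS card_gt_0_iff[of S] by (auto simp: Suc_le_eq)
    ultimately have "real (card S) - 1 \<le> real (card N)" "real (card S) \<ge> 1" by linarith+
    with \<open>E \<subseteq> _\<close> sum show ?thesis by simp
  qed
qed

text \<open>Insert the edges one by one. A new edge either reuses one of at most
  \<open>card E\<close> colours at no cost or takes any colour at cost \<open>1 / card I\<close>, in
  total a factor of at most \<open>card E + 1\<close>. The bound does not grow with the number of
  layers.\<close>

lemma sum_colourings_weight_le:
  assumes I: "finite I" "card I > 0" and E: "finite E"
  shows "(\<Sum>c\<in>E \<rightarrow>\<^sub>E I. (1 / real (card I)) ^ card (c ` E)) \<le> fact (card E)"
  using E
proof induction
  case (insert x E)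
  let ?w = "1 / real (card I)"
  have "(\<Sum>c\<in>insert x E \<rightarrow>\<^sub>E I. ?w ^ card (c ` insert x E))
    = (\<Sum>(y, c)\<in>I \<times> (E \<rightarrow>\<^sub>E I). ?w ^ card ((c(x := y)) ` insert x E))"
    unfolding PiE_insert_eq
    by (subst sum.reindex[OF inj_combinator[OF insert(2)]]) (simp add: case_prod_beta' o_def del: fun_upd_apply image_insert)
  also have "\<dots> = (\<Sum>(y, c)\<in>I \<times> (E \<rightarrow>\<^sub>E I). ?w ^ card (insert y (c ` E)))"
  proof (intro sum.cong refl, clarify)
    fix y c
    have "(c(x := y)) ` insert x E = insert y (c ` E)" using insert(2) by auto
    then show "?w ^ card ((c(x := y)) ` insert x E) = ?w ^ card (insert y (c ` E))" by simp
  qed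
  also have "\<dots> = (\<Sum>c\<in>E \<rightarrow>\<^sub>E I. \<Sum>y\<in>I. ?w ^ card (insert y (c ` E)))"
    by (subst sum.cartesian_product[symmetric]) (rule sum.swap)
  also have "\<dots> \<le> (\<Sum>c\<in>E \<rightarrow>\<^sub>E I. real (Suc (card E)) * ?w ^ card (c ` E))"
  proof (rule sum_mono)
    fix c assume "c \<in> E \<rightarrow>\<^sub>E I"
    then have sub: "c ` E \<subseteq> I" by auto
    let ?R = "c ` E"
    \<comment> \<open>The cost of a fresh colour is charged for every \<open>y\<close>, also for
      those already used, so that the sum evaluates directly.\<close>
    have "(\<Sum>y\<in>I. ?w ^ card (insert y ?R)) \<le> (\<Sum>y\<in>I. (if y \<in> ?R then ?w ^ card ?R else 0) + ?w * ?w ^ card ?R)"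
      using insert(1) by (intro sum_mono) (simp add: insert_absorb)
    also have "\<dots> = real (card ?R) * ?w ^ card ?R + real (card I) * (?w * ?w ^ card ?R)"
      using I sub by (simp add: sum.distrib sum.If_cases Int_absorb1)
    also have "\<dots> = real (Suc (card ?R)) * ?w ^ card ?R"
      using I by (auto simp: algebra_simps)
    also have "\<dots> \<le> real (Suc (card E)) * ?w ^ card ?R"
      using card_image_le[OF insert(1), of c] by (intro mult_right_mono) auto
    finally show "(\<Sum>y\<in>I. ?w ^ card (insert y ?R)) \<le> real (Suc (card E)) * ?w ^ card ?R" .
  qed
  also have "\<dots> = real (Suc (card E)) * (\<Sum>c\<in>E \<rightarrow>\<^sub>E I. ?w ^ card (c ` E))"
    by (simp add: sum_distrib_left)
  also have "\<dots> \<le> real (Suc (card E)) * fact (card E)"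
    by (intro mult_left_mono insert.IH) simp
  also have "\<dots> = fact (card (insert x E))" using insert(1,2) by simp
  finally show ?case .
qed simp

lemma prob_Pi_pmf_colouring:
  fixes \<kappa> :: "'v ugraph pmf"
  assumes I: "finite I" and E: "finite E" and c: "c \<in> E \<rightarrow>\<^sub>E I"
  shows "measure_pmf.prob (Pi_pmf I d (\<lambda>_. \<kappa>)) {L. \<forall>e\<in>E. e \<in> edges (L (c e))}
    = (\<Prod>j\<in>c ` E. measure_pmf.prob \<kappa> {G. {e \<in> E. c e = j} \<subseteq> edges G})"
proof -
  let ?B = "\<lambda>j. {G :: 'v ugraph. {e \<in> E. c e = j} \<subseteq> edges G}"
  have eq: "{L. \<forall>e\<in>E. e \<in> edges (L (c e))} = Pi I ?B" using c by (auto simp: Pi_def PiE_def)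
  have "measure_pmf.prob (Pi_pmf I d (\<lambda>_. \<kappa>)) {L. \<forall>e\<in>E. e \<in> edges (L (c e))}
    = (\<Prod>j\<in>I. measure_pmf.prob \<kappa> (?B j))"
    unfolding eq by (rule measure_Pi_pmf_Pi[OF I])
  also have "\<dots> = (\<Prod>j\<in>c ` E. measure_pmf.prob \<kappa> (?B j))"
  proof (rule prod.mono_neutral_right[OF I])
    show "c ` E \<subseteq> I" using c by auto
    show "\<forall>j\<in>I - c ` E. measure_pmf.prob \<kappa> (?B j) = 1"
    proof
      fix j assume "j \<in> I - c ` E"
      then have "?B j = UNIV" by auto
      then show "measure_pmf.prob \<kappa> (?B j) = 1" by (simp only: measure_pmf_UNIV)
    qed
  qed
  finally show ?thesis .
qed

text \<open>Multiply the bounds of the classes: by the rank inequality the exponents of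
  \<open>r\<close> add up to at least \<open>card (verts F)\<close>, and one factor
  \<open>\<delta>\<close> is retained. The power of \<open>w\<close> records the number of colours
  for the sum over colourings.\<close>

lemma copy_colouring_prob_le:
  assumes F: "simple_graph F" "two_connected F" "card (verts F) \<ge> 3"
    and H: "simple_graph H" "isomorphic F H" "verts H \<subseteq> {1..n}"
    and c: "e\<^sub>1 \<in> edges H" "e\<^sub>2 \<in> edges H" "c e\<^sub>1 \<noteq> c e\<^sub>2"
    and \<kappa>: "\<And>A. A \<subseteq> vertex_pairs {1..n} \<Longrightarrow> A \<noteq> {} \<Longrightarrow>
      measure_pmf.prob \<kappa> {G. A \<subseteq> edges G} \<le> \<mu> (min (card A) (card (\<Union>A) - 1))"
    and \<mu>: "\<And>s. s \<in> {1..card (verts F) - 1} \<Longrightarrow> \<mu> s \<le> w * \<delta> * r ^ s"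
    and w: "0 \<le> w" and \<delta>: "0 \<le> \<delta>" "\<delta> \<le> 1" and r: "0 \<le> r" "r \<le> 1"
  shows "(\<Prod>j\<in>c ` edges H. measure_pmf.prob \<kappa> {G. {e \<in> edges H. c e = j} \<subseteq> edges G})
    \<le> w ^ card (c ` edges H) * (\<delta> * r ^ card (verts F))"
proof -
  have finV: "finite (verts H)" and sub: "edges H \<subseteq> vertex_pairs (verts H)"
    using H unfolding simple_graph_def by auto
  have finE: "finite (edges H)" using sub finite_vertex_pairs[OF finV] by (rule finite_subset)
  have card_V: "card (verts H) = card (verts F)"
    using H(2) bij_betw_same_card unfolding isomorphic_def by metis
  let ?A = "\<lambda>j. {e \<in> edges H. c e = j}" and ?J = "c ` edges H"
  let ?rk = "\<lambda>j. min (card (?A j)) (card (\<Union>(?A j)) - 1)"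
  have "(\<Prod>j\<in>?J. measure_pmf.prob \<kappa> {G. ?A j \<subseteq> edges G}) \<le> (\<Prod>j\<in>?J. w * \<delta> * r ^ ?rk j)"
  proof (rule prod_mono, rule conjI)
    fix j assume "j \<in> ?J"
    then obtain e where e: "e \<in> edges H" "c e = j" by blast
    have A: "?A j \<subseteq> vertex_pairs {1..n}" "?A j \<noteq> {}"
      using sub H(3) e unfolding vertex_pairs_def by auto
    have U: "\<Union>(?A j) \<subseteq> verts H" using sub unfolding vertex_pairs_def by auto
    have e2: "card e = 2" "e \<subseteq> \<Union>(?A j)" using e sub unfolding vertex_pairs_def by auto
    have "2 \<le> card (\<Union>(?A j))" using card_mono[OF finite_subset[OF U finV] e2(2)] e2(1) by simp
    moreover have "1 \<le> card (?A j)" using finE A(2) by (simp add: Suc_leI card_gt_0_iff)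
    moreover have "card (\<Union>(?A j)) \<le> card (verts F)" using card_mono[OF finV U] card_V by simp
    \<comment> \<open>A class contains an edge and spans at most all vertices, so its rank is in the
      range where \<open>\<mu>\<close> is controlled.\<close>
    ultimately have "?rk j \<in> {1..card (verts F) - 1}"
      unfolding atLeastAtMost_iff by linarith
    then show "measure_pmf.prob \<kappa> {G. ?A j \<subseteq> edges G} \<le> w * \<delta> * r ^ ?rk j"
      by (rule order_trans[OF \<kappa>[OF A] \<mu>])
  qed simp
  also have "\<dots> = w ^ card ?J * \<delta> ^ card ?J * r ^ (\<Sum>j\<in>?J. ?rk j)"
    by (simp add: prod.distrib power_sum power_mult_distrib)
  also have "\<dots> \<le> w ^ card ?J * (\<delta> * r ^ card (verts F))"
  proof -
    have "r ^ (\<Sum>j\<in>?J. ?rk j) \<le> r ^ card (verts F)"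
      using copy_colouring_rank[OF F H(2) c] r by (intro power_decreasing) auto
    moreover have "card ?J \<noteq> 0" using c(1) finE by auto
    then have "\<delta> ^ card ?J \<le> \<delta> ^ 1" using \<delta> by (intro power_decreasing) auto
    ultimately have "\<delta> ^ card ?J * r ^ (\<Sum>j\<in>?J. ?rk j) \<le> \<delta> * r ^ card (verts F)"
      using \<delta> r by (intro mult_mono) auto
    then show ?thesis using w by (simp add: mult.assoc mult_left_mono)
  qed
  finally show ?thesis .
qed

text \<open>The three ingredients are the number of potential copies, at most
  \<open>n ^ card (verts F)\<close>, the probability that a given non-constant colouring is
  realised, and the weighted sum over colourings, which yields the factorial.\<close>

lemma expectation_abs_num_copies_union_diff_le:
  fixes \<kappa> :: "nat ugraph pmf" and F :: "'a ugraph"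
  assumes F: "simple_graph F" "two_connected F" "card (verts F) \<ge> 3"
    and m: "m > 0"
    and supp: "set_pmf \<kappa> \<subseteq> {G. verts G \<subseteq> {1..n} \<and> edges G \<subseteq> vertex_pairs (verts G)}"
    and \<kappa>: "\<And>A. A \<subseteq> vertex_pairs {1..n} \<Longrightarrow> A \<noteq> {} \<Longrightarrow>
      measure_pmf.prob \<kappa> {G. A \<subseteq> edges G} \<le> \<mu> (min (card A) (card (\<Union>A) - 1))"
    and \<mu>: "\<And>s. s \<in> {1..card (verts F) - 1} \<Longrightarrow> real m * \<mu> s \<le> \<delta> * r ^ s"
    and \<delta>: "0 \<le> \<delta>" "\<delta> \<le> 1" and r: "0 \<le> r" "r \<le> 1"
  defines "\<Lambda> \<equiv> Pi_pmf {1..m} \<lparr>verts = {}, edges = {}\<rparr> (\<lambda>_. \<kappa>)"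
  shows "finite (set_pmf \<Lambda>)"
    and "measure_pmf.expectation \<Lambda> (\<lambda>L. \<bar>real (num_copies F (union_layers n m L)) - (\<Sum>i\<in>{1..m}. real (num_copies F (L i)))\<bar>)
      \<le> fact (card (edges F)) * \<delta> * (real n * r) ^ card (verts F)"
proof -
  let ?T = "{G :: nat ugraph. verts G \<subseteq> {1..n} \<and> edges G \<subseteq> vertex_pairs (verts G)}"
  let ?d = "\<lparr>verts = {}, edges = {}\<rparr> :: nat ugraph"
  let ?K = "copies F (complete_graph {1..n})" and ?h = "card (verts F)"
  have "?T \<subseteq> {G. verts G \<subseteq> {1..n} \<and> edges G \<subseteq> vertex_pairs {1..n}}"
    unfolding vertex_pairs_def by auto
  then have finT: "finite ?T" by (rule finite_subset) (simp add: finite_graphs)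
  have supp\<Lambda>: "set_pmf \<Lambda> \<subseteq> PiE_dflt {1..m} ?d (\<lambda>_. ?T)"
    unfolding \<Lambda>_def set_Pi_pmf[OF finite_atLeastAtMost] o_def by (rule PiE_dflt_mono[OF supp])
  \<comment> \<open>There are finitely many graphs on \<open>{1..n}\<close>, so every function is
    integrable under \<open>\<Lambda>\<close>.\<close>
  show fin: "finite (set_pmf \<Lambda>)"
    by (rule finite_subset[OF supp\<Lambda>]) (intro finite_PiE_dflt finT finite_atLeastAtMost)
  have int: "integrable (measure_pmf \<Lambda>) f" for f :: "(nat \<Rightarrow> nat ugraph) \<Rightarrow> real"
    by (rule integrable_measure_pmf_finite[OF fin])
  have F_Un: "verts F = \<Union>(edges F)" by (rule two_connected_verts_eq_Union_edges[OF F])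
  obtain f\<^sub>1 f\<^sub>2 where f12: "f\<^sub>1 \<in> edges F" "f\<^sub>2 \<in> edges F" "f\<^sub>1 \<noteq> f\<^sub>2"
    by (rule two_connected_distinct_edges[OF F])
  have K: "finite ?K" by (intro finite_copies) (simp add: complete_graph_def)
  let ?N = "\<lambda>H. {c \<in> edges H \<rightarrow>\<^sub>E {1..m}. \<exists>e\<in>edges H. \<exists>e'\<in>edges H. c e \<noteq> c e'}"
  have H: "simple_graph H" "isomorphic F H" "verts H \<subseteq> {1..n}" "finite (edges H)"
    "card (edges H) = card (edges F)" "\<exists>e\<^sub>1\<in>edges H. \<exists>e\<^sub>2\<in>edges H. e\<^sub>1 \<noteq> e\<^sub>2" if "H \<in> ?K" for H
  proof -
    show "simple_graph H" and iso: "isomorphic F H" and "verts H \<subseteq> {1..n}"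
      using that unfolding copies_def complete_graph_def subgraph_def by auto
    then show "finite (edges H)"
      using finite_vertex_pairs finite_subset unfolding simple_graph_def by blast
    obtain f where f: "bij_betw f (verts F) (verts H)" "edges H = image f ` edges F"
      using iso unfolding isomorphic_def by blast
    have inj: "inj_on (image f) (edges F)"
    proof (rule inj_on_subset[OF inj_on_image_Pow])
      show "inj_on f (verts F)" using f(1) unfolding bij_betw_def by blast
      show "edges F \<subseteq> Pow (verts F)" using F(1) unfolding simple_graph_def vertex_pairs_def by auto
    qed
    then show "card (edges H) = card (edges F)" unfolding f(2) by (rule card_image)
    have "f ` f\<^sub>1 \<noteq> f ` f\<^sub>2" using inj f12 unfolding inj_on_def by blast
    then show "\<exists>e\<^sub>1\<in>edges H. \<exists>e\<^sub>2\<in>edges H. e\<^sub>1 \<noteq> e\<^sub>2" 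
      using f12 unfolding f(2) by (intro bexI[of _ "f ` f\<^sub>1"] bexI[of _ "f ` f\<^sub>2"]) auto
  qed
  have finN: "finite (?N H)" if "H \<in> ?K" for H
    using finite_PiE[OF H(4)[OF that], of "\<lambda>_. {1..m}"] by auto
  \<comment> \<open>After swapping the sums over layers and potential copies, the error is bounded
    separately for each potential copy.\<close>
  have pointwise: "\<bar>real (num_copies F (union_layers n m L)) - (\<Sum>i\<in>{1..m}. real (num_copies F (L i)))\<bar>
    \<le> (\<Sum>H\<in>?K. \<Sum>c\<in>?N H. indicator {L. \<forall>e\<in>edges H. e \<in> edges (L (c e))} L)"
    if L: "\<And>i. i \<in> {1..m} \<Longrightarrow> L i \<in> ?T" for L
  proof -
    let ?U = "\<Union>i\<in>{1..m}. edges (L i)"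
    have "vertex_pairs (verts (L i)) \<subseteq> vertex_pairs {1..n}" if "i \<in> {1..m}" for i
      using L[OF that] unfolding vertex_pairs_def by blast
    then have "?U \<subseteq> vertex_pairs {1..n}" using L by blast
    then have "real (num_copies F (union_layers n m L)) = (\<Sum>H\<in>?K. of_bool (edges H \<subseteq> ?U))"
      by (subst num_copies_eq_sum[OF F_Un]) (simp_all add: union_layers_def)
    moreover have "(\<Sum>i\<in>{1..m}. real (num_copies F (L i))) = (\<Sum>i\<in>{1..m}. \<Sum>H\<in>?K. of_bool (edges H \<subseteq> edges (L i)))"
      using L by (intro sum.cong refl num_copies_eq_sum[OF F_Un]) auto
    moreover have "\<dots> = (\<Sum>H\<in>?K. \<Sum>i\<in>{1..m}. of_bool (edges H \<subseteq> edges (L i)))"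
      by (rule sum.swap)
    ultimately have "\<bar>real (num_copies F (union_layers n m L)) - (\<Sum>i\<in>{1..m}. real (num_copies F (L i)))\<bar>
      = \<bar>\<Sum>H\<in>?K. of_bool (edges H \<subseteq> ?U) - (\<Sum>i\<in>{1..m}. of_bool (edges H \<subseteq> edges (L i)))\<bar>"
      by (simp only: sum_subtractf)
    also have "\<dots> \<le> (\<Sum>H\<in>?K. \<bar>of_bool (edges H \<subseteq> ?U) - (\<Sum>i\<in>{1..m}. of_bool (edges H \<subseteq> edges (L i)))\<bar>)"
      by (rule sum_abs)
    also have "\<dots> \<le> (\<Sum>H\<in>?K. \<Sum>c\<in>?N H. indicator {L. \<forall>e\<in>edges H. e \<in> edges (L (c e))} L)"
    proof (rule sum_mono)
      fix H assume HK: "H \<in> ?K"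
      obtain e1 e2 where e12: "e1 \<in> edges H" "e2 \<in> edges H" "e1 \<noteq> e2" using H(6)[OF HK] by blast
      have "(\<Sum>c\<in>?N H. indicator {L. \<forall>e\<in>edges H. e \<in> edges (L (c e))} L) =
        real (card {c \<in> ?N H. \<forall>e\<in>edges H. e \<in> edges (L (c e))})"
        using finN[OF HK] by (simp add: indicator_def sum.If_cases Collect_conj_eq Int_assoc)
      also have "{c \<in> ?N H. \<forall>e\<in>edges H. e \<in> edges (L (c e))} = {c \<in> edges H \<rightarrow>\<^sub>E {1..m}.
        (\<exists>e\<in>edges H. \<exists>e'\<in>edges H. c e \<noteq> c e') \<and> (\<forall>e\<in>edges H. e \<in> edges (L (c e)))}"
        by blast
      finally show "\<bar>of_bool (edges H \<subseteq> ?U) - (\<Sum>i\<in>{1..m}. of_bool (edges H \<subseteq> edges (L i)))\<bar>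
        \<le> (\<Sum>c\<in>?N H. indicator {L. \<forall>e\<in>edges H. e \<in> edges (L (c e))} L :: real)"
        using abs_covered_diff_le_card_colourings[OF _ H(4)[OF HK] e12, of "{1..m}" "\<lambda>i. edges (L i)"]
        by simp
    qed
    finally show ?thesis .
  qed
  have "measure_pmf.expectation \<Lambda> (\<lambda>L. \<bar>real (num_copies F (union_layers n m L)) - (\<Sum>i\<in>{1..m}. real (num_copies F (L i)))\<bar>)
    \<le> measure_pmf.expectation \<Lambda> (\<lambda>L. \<Sum>H\<in>?K. \<Sum>c\<in>?N H. indicator {L. \<forall>e\<in>edges H. e \<in> edges (L (c e))} L)"
  proof (rule integral_mono_AE[OF int int], subst AE_measure_pmf_iff, rule ballI, rule pointwise)
    fix L i assume "L \<in> set_pmf \<Lambda>" "i \<in> {1..m}"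
    then show "L i \<in> ?T" using supp\<Lambda> unfolding PiE_dflt_def by blast
  qed
  also have "\<dots> = (\<Sum>H\<in>?K. \<Sum>c\<in>?N H. measure_pmf.prob \<Lambda> {L. \<forall>e\<in>edges H. e \<in> edges (L (c e))})"
    by (simp add: Bochner_Integration.integral_sum int)
  also have "\<dots> \<le> (\<Sum>H\<in>?K. fact (card (edges F)) * \<delta> * r ^ ?h)"
  proof (rule sum_mono)
    fix H assume HK: "H \<in> ?K"
    note H = H[OF HK]
    let ?w = "1 / real m"
    have "(\<Sum>c\<in>?N H. measure_pmf.prob \<Lambda> {L. \<forall>e\<in>edges H. e \<in> edges (L (c e))})
      \<le> (\<Sum>c\<in>?N H. ?w ^ card (c ` edges H) * (\<delta> * r ^ ?h))"
    proof (rule sum_mono)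
      fix c assume "c \<in> ?N H"
      then obtain e e' where c: "c \<in> edges H \<rightarrow>\<^sub>E {1..m}" "e \<in> edges H" "e' \<in> edges H" "c e \<noteq> c e'"
        by blast
      \<comment> \<open>Dividing by the number of layers gives the weight \<open>1 / m\<close> for
        each colour used.\<close>
      have "\<mu> s \<le> ?w * \<delta> * r ^ s" if "s \<in> {1..?h - 1}" for s
        using \<mu>[OF that] m by (simp add: field_simps)
      then show "measure_pmf.prob \<Lambda> {L. \<forall>e\<in>edges H. e \<in> edges (L (c e))}
        \<le> ?w ^ card (c ` edges H) * (\<delta> * r ^ ?h)"
        unfolding \<Lambda>_def prob_Pi_pmf_colouring[OF finite_atLeastAtMost H(4) c(1)]
        by (intro copy_colouring_prob_le[OF F H(1-3) c(2-4) \<kappa> _ _ \<delta> r]) simp_all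
    qed
    \<comment> \<open>Constant colourings are put back, with nonnegative terms, because the weighted
      sum is bounded over all colourings.\<close>
    also have "\<dots> \<le> (\<Sum>c\<in>edges H \<rightarrow>\<^sub>E {1..m}. ?w ^ card (c ` edges H) * (\<delta> * r ^ ?h))"
    proof (rule sum_mono2)
      show "finite (edges H \<rightarrow>\<^sub>E {1..m})" by (intro finite_PiE H(4)) simp
      show "?N H \<subseteq> edges H \<rightarrow>\<^sub>E {1..m}" by blast
      show "0 \<le> ?w ^ card (c ` edges H) * (\<delta> * r ^ ?h)" for c
        using \<delta>(1) r(1) by (intro mult_nonneg_nonneg zero_le_power) simp_all
    qed
    also have "\<dots> = (\<Sum>c\<in>edges H \<rightarrow>\<^sub>E {1..m}. ?w ^ card (c ` edges H)) * (\<delta> * r ^ ?h)"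
      by (rule sum_distrib_right[symmetric])
    also have "\<dots> \<le> fact (card (edges H)) * (\<delta> * r ^ ?h)"
      using sum_colourings_weight_le[of "{1..m}" "edges H"] m H(4) \<delta> r by (intro mult_right_mono) auto
    finally show "(\<Sum>c\<in>?N H. measure_pmf.prob \<Lambda> {L. \<forall>e\<in>edges H. e \<in> edges (L (c e))})
      \<le> fact (card (edges F)) * \<delta> * r ^ ?h" using H(5) by (simp add: mult.assoc)
  qed
  also have "\<dots> = real (card ?K) * (fact (card (edges F)) * \<delta> * r ^ ?h)" by simp
  also have "\<dots> \<le> real (n ^ ?h) * (fact (card (edges F)) * \<delta> * r ^ ?h)"
  proof (intro mult_right_mono of_nat_mono)
    show "card ?K \<le> n ^ ?h"
      using card_copies_complete_graph_le[of F "{1..n}"] F(1) unfolding simple_graph_def by simp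
  qed (use \<delta> r in auto)
  also have "\<dots> = fact (card (edges F)) * \<delta> * (real n * r) ^ ?h" by (simp add: power_mult_distrib)
  finally show "measure_pmf.expectation \<Lambda> (\<lambda>L. \<bar>real (num_copies F (union_layers n m L)) - (\<Sum>i\<in>{1..m}. real (num_copies F (L i)))\<bar>)
    \<le> fact (card (edges F)) * \<delta> * (real n * r) ^ card (verts F)" .
qed

section \<open>Characteristic functions of dominated arrays\<close>

lemma norm_iexp_diff_le: "cmod (iexp x - iexp y) \<le> \<bar>x - y\<bar>"
proof -
  have "iexp x - iexp y = iexp y * (iexp (x - y) - 1)"
    by (simp add: algebra_simps flip: exp_add)
  then have "cmod (iexp x - iexp y) = cmod (iexp (x - y) - 1)" by (simp add: norm_mult)
  also have "\<dots> \<le> \<bar>x - y\<bar>" using iexp_approx1[of "x - y" 0] by simp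
  finally show ?thesis .
qed

text \<open>Lindeberg's condition holds because the whole array is dominated by one square integrable
  variable.\<close>
lemma (in prob_space) dominated_array_char_tendsto:
  fixes Y :: "nat \<Rightarrow> 'a \<Rightarrow> real" and Z :: "'a \<Rightarrow> real" and m :: "nat \<Rightarrow> nat"
  assumes [measurable]: "\<And>k. Y k \<in> borel_measurable M" "Z \<in> borel_measurable M"
    and sq: "integrable M (\<lambda>\<omega>. (Z \<omega>)\<^sup>2)"
    and dom: "AE \<omega> in M. \<forall>k. \<bar>Y k \<omega>\<bar> \<le> Z \<omega>"
    and lim: "AE \<omega> in M. (\<lambda>k. Y k \<omega>) \<longlonglongrightarrow> Z \<omega>"
    and m: "filterlim m at_top sequentially"
    and \<sigma>: "\<sigma> > 0" "variance Z = \<sigma>\<^sup>2"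
  shows "(\<lambda>k. expectation (\<lambda>\<omega>. iexp (t / (\<sigma> * sqrt (real (m k))) * (Y k \<omega> - expectation (Y k)))) ^ m k)
    \<longlonglongrightarrow> complex_of_real (exp (- t\<^sup>2 / 2))"
proof -
  have int_Z: "integrable M Z" by (rule square_integrable_imp_integrable[OF _ sq]) simp
  have int_Y: "integrable M (Y k)" for k
    by (rule Bochner_Integration.integrable_bound[OF int_Z])
      (use dom in \<open>auto elim!: eventually_mono intro: order_trans[OF _ abs_ge_self]\<close>)
  have int_Y2: "integrable M (\<lambda>\<omega>. (Y k \<omega>)\<^sup>2)" for k
    by (rule Bochner_Integration.integrable_bound[OF sq])
      (use dom in \<open>auto elim!: eventually_mono simp: abs_le_square_iff[symmetric] intro: order_trans[OF _ abs_ge_self]\<close>)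
  define c where "c k = expectation (Y k)" for k
  define C where "C = expectation Z"
  define W where "W k \<omega> = Y k \<omega> - c k" for k \<omega>
  have [measurable]: "W k \<in> borel_measurable M" for k unfolding W_def by measurable
  have c_lim: "c \<longlonglongrightarrow> C"
    unfolding c_def[abs_def] C_def
    by (rule integral_dominated_convergence[where w = Z]) (use int_Z lim in \<open>auto intro: eventually_mono[OF dom]\<close>)
  have abs_c: "\<bar>c k\<bar> \<le> C" for k
    unfolding c_def C_def
  proof (rule order_trans[OF integral_abs_bound])
    have "AE \<omega> in M. \<bar>Y k \<omega>\<bar> \<le> Z \<omega>" using dom by eventually_elim blast
    then show "expectation (\<lambda>\<omega>. \<bar>Y k \<omega>\<bar>) \<le> expectation Z"
      by (intro integral_mono_AE integrable_abs int_Y int_Z)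
  qed
  have W_le: "AE \<omega> in M. \<forall>k. \<bar>W k \<omega>\<bar> \<le> Z \<omega> + C"
    using dom
  proof eventually_elim
    case (elim \<omega>)
    show ?case
    proof
      fix k
      show "\<bar>W k \<omega>\<bar> \<le> Z \<omega> + C" using spec[OF elim, of k] abs_c[of k] unfolding W_def by linarith
    qed
  qed
  have int_ZC: "integrable M (\<lambda>\<omega>. (Z \<omega> + C)\<^sup>2)"
    using sq int_Z by (simp add: power2_sum)
  have EW: "expectation (W k) = 0" for k
    unfolding W_def c_def using int_Y by (simp add: prob_space)
  have int_W: "integrable M (W k)" "integrable M (\<lambda>\<omega>. (W k \<omega>)\<^sup>2)" for k
    unfolding W_def using int_Y int_Y2 by (simp_all add: power2_diff)
  define v where "v k = variance (W k)" for k
  have v_lim: "v \<longlonglongrightarrow> \<sigma>\<^sup>2"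
  proof -
    have "(\<lambda>k. expectation (\<lambda>\<omega>. (W k \<omega>)\<^sup>2)) \<longlonglongrightarrow> expectation (\<lambda>\<omega>. (Z \<omega> - C)\<^sup>2)"
    proof (rule integral_dominated_convergence[where w = "\<lambda>\<omega>. (Z \<omega> + C)\<^sup>2"])
      show "AE \<omega> in M. (\<lambda>k. (W k \<omega>)\<^sup>2) \<longlonglongrightarrow> (Z \<omega> - C)\<^sup>2"
        unfolding W_def using lim by eventually_elim (intro tendsto_intros c_lim)
      show "AE \<omega> in M. norm ((W k \<omega>)\<^sup>2) \<le> (Z \<omega> + C)\<^sup>2" for k
        using W_le by eventually_elim (auto simp: abs_le_square_iff[symmetric] intro: order_trans[OF _ abs_ge_self])
    qed (use int_ZC in auto)
    then show ?thesis unfolding v_def \<sigma>(2)[symmetric] EW C_def by simp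
  qed
  define u where "u k = t / (\<sigma> * sqrt (real (m k)))" for k
  define \<phi> where "\<phi> k = expectation (\<lambda>\<omega>. iexp (u k * W k \<omega>))" for k
  define R where "R k = expectation (\<lambda>\<omega>. min (6 * (W k \<omega>)\<^sup>2) (\<bar>u k\<bar> * \<bar>W k \<omega>\<bar> ^ 3))" for k
  have \<phi>_char: "\<phi> k = char (distr M borel (W k)) (u k)" for k
    unfolding \<phi>_def char_def by (simp add: integral_distr)
  \<comment> \<open>A second-order expansion whose remainder takes the smaller of a quadratic and a
    cubic term.\<close>
  have \<phi>_approx: "cmod (\<phi> k - (1 - (u k)\<^sup>2 * v k / 2)) \<le> (u k)\<^sup>2 / 6 * R k" for k
    unfolding \<phi>_char R_def
    using char_approx3'[of "W k" "v k" "distr M borel (W k)" "u k"] int_W EW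
    by (simp add: v_def)
  have m_real: "filterlim (\<lambda>k. real (m k)) at_top sequentially"
    using m by (rule filterlim_compose[OF filterlim_real_sequentially])
  have u_lim: "u \<longlonglongrightarrow> 0"
    unfolding u_def[abs_def]
    by (intro tendsto_divide_0[OF tendsto_const] filterlim_at_top_imp_at_infinity
        filterlim_tendsto_pos_mult_at_top[OF tendsto_const \<sigma>(1)] filterlim_compose[OF sqrt_at_top m_real])
  have R_lim: "R \<longlonglongrightarrow> 0"
  proof -
    have "R \<longlonglongrightarrow> expectation (\<lambda>_. 0)"
      unfolding R_def[abs_def]
    \<comment> \<open>The quadratic branch of the minimum supplies the integrable bound, the cubic
      branch with its factor \<open>u k\<close> the pointwise limit 0.\<close>
    proof (rule integral_dominated_convergence[where w = "\<lambda>\<omega>. 6 * (Z \<omega> + C)\<^sup>2"])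
      show "AE \<omega> in M. (\<lambda>k. min (6 * (W k \<omega>)\<^sup>2) (\<bar>u k\<bar> * \<bar>W k \<omega>\<bar> ^ 3)) \<longlonglongrightarrow> 0"
        using W_le
      proof eventually_elim
        case (elim \<omega>)
        have "(\<lambda>k. \<bar>u k\<bar> * (Z \<omega> + C) ^ 3) \<longlonglongrightarrow> 0"
          using tendsto_mult_left_zero[OF tendsto_rabs_zero[OF u_lim]] .
        then show ?case
          by (rule real_tendsto_sandwich[OF _ _ tendsto_const, rotated 2])
            (auto intro!: always_eventually min.coboundedI2 mult_left_mono power_mono spec[OF elim])
      qed
      show "AE \<omega> in M. norm (min (6 * (W k \<omega>)\<^sup>2) (\<bar>u k\<bar> * \<bar>W k \<omega>\<bar> ^ 3)) \<le> 6 * (Z \<omega> + C)\<^sup>2" for k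
        using W_le
      proof eventually_elim
        case (elim \<omega>)
        have "\<bar>W k \<omega>\<bar> \<le> \<bar>Z \<omega> + C\<bar>" using spec[OF elim, of k] by linarith
        then have "(W k \<omega>)\<^sup>2 \<le> (Z \<omega> + C)\<^sup>2" by (simp add: abs_le_square_iff)
        then show ?case
          by (auto simp: min_def)
      qed
    qed (use int_ZC in auto)
    then show ?thesis by simp
  qed
  \<comment> \<open>\<open>m k\<close> times the error of one factor, simplified by
    \<open>m k * (u k)\<^sup>2 = t\<^sup>2 / \<sigma>\<^sup>2\<close>.\<close>
  define B where "B k = t\<^sup>2 / (6 * \<sigma>\<^sup>2) * R k + t\<^sup>2 / 2 * \<bar>v k / \<sigma>\<^sup>2 - 1\<bar>" for k
  have B_lim: "B \<longlonglongrightarrow> 0"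
  proof -
    have "(\<lambda>k. t\<^sup>2 / (6 * \<sigma>\<^sup>2) * R k + t\<^sup>2 / 2 * \<bar>v k / \<sigma>\<^sup>2 - 1\<bar>)
      \<longlonglongrightarrow> t\<^sup>2 / (6 * \<sigma>\<^sup>2) * 0 + t\<^sup>2 / 2 * \<bar>\<sigma>\<^sup>2 / \<sigma>\<^sup>2 - 1\<bar>"
      using \<sigma>(1) by (intro tendsto_intros R_lim v_lim) auto
    then show ?thesis unfolding B_def[abs_def] using \<sigma>(1) by simp
  qed
  have ev: "\<forall>\<^sub>F k in sequentially. cmod (\<phi> k ^ m k - (1 + (- (t\<^sup>2) / 2) / of_nat (m k)) ^ m k) \<le> B k"
  proof -
    \<comment> \<open>Once \<open>m k \<ge> t\<^sup>2\<close>, the number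
      \<open>1 - t\<^sup>2 / (2 * m k)\<close> has modulus at most 1, so powers differ by at most
      \<open>m k\<close> times the difference of their bases.\<close>
    have "\<forall>\<^sub>F k in sequentially. real (m k) \<ge> max 1 (t\<^sup>2)"
      using m_real unfolding filterlim_at_top by (rule spec)
    then show ?thesis
    proof eventually_elim
      case (elim k)
      define M' where "M' = real (m k)"
      have M': "M' \<ge> 1" "M' \<ge> t\<^sup>2" using elim by (auto simp: M'_def)
      have u2: "(u k)\<^sup>2 = t\<^sup>2 / (\<sigma>\<^sup>2 * M')" unfolding u_def M'_def
        by (simp add: power_divide power_mult_distrib)
      let ?w = "1 + (- (t\<^sup>2) / 2) / M'"
      have "cmod (\<phi> k) \<le> 1"
        unfolding \<phi>_char by (intro real_distribution.cmod_char_le_1 real_distribution_distr) simp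
      moreover have "\<bar>?w\<bar> \<le> 1" using M' by (intro abs_leI) (auto simp: field_simps)
      then have "cmod (complex_of_real ?w) \<le> 1" by (simp only: norm_of_real)
      ultimately have "cmod (\<phi> k ^ m k - (complex_of_real ?w) ^ m k) \<le> m k * cmod (\<phi> k - complex_of_real ?w)"
        by (rule norm_power_diff)
      also have "\<dots> \<le> M' * ((u k)\<^sup>2 / 6 * R k + \<bar>(u k)\<^sup>2 * v k / 2 - t\<^sup>2 / 2 / M'\<bar>)"
      proof -
        have "cmod (\<phi> k - complex_of_real ?w) \<le> cmod (\<phi> k - (1 - (u k)\<^sup>2 * v k / 2))
          + cmod ((1 - (u k)\<^sup>2 * v k / 2) - complex_of_real ?w)"
          using norm_triangle_ineq[of "\<phi> k - (1 - (u k)\<^sup>2 * v k / 2)" "(1 - (u k)\<^sup>2 * v k / 2) - complex_of_real ?w"]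
          by (simp only: diff_add_cancel add_diff_eq)
        moreover have "(1 - (u k)\<^sup>2 * v k / 2) - complex_of_real ?w
          = complex_of_real (- ((u k)\<^sup>2 * v k / 2 - t\<^sup>2 / 2 / M'))" by simp
        then have "cmod ((1 - (u k)\<^sup>2 * v k / 2) - complex_of_real ?w) = \<bar>(u k)\<^sup>2 * v k / 2 - t\<^sup>2 / 2 / M'\<bar>"
          by (simp only: norm_of_real abs_minus_cancel)
        ultimately have "cmod (\<phi> k - complex_of_real ?w) \<le> (u k)\<^sup>2 / 6 * R k + \<bar>(u k)\<^sup>2 * v k / 2 - t\<^sup>2 / 2 / M'\<bar>"
          using \<phi>_approx[of k] by linarith
        then show ?thesis unfolding M'_def by (intro mult_left_mono) auto
      qed
      also have "\<dots> = B k"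
      proof -
        have "M' * ((u k)\<^sup>2 / 6 * R k) = t\<^sup>2 / (6 * \<sigma>\<^sup>2) * R k"
          using M'(1) \<sigma>(1) unfolding u2 by (simp add: field_simps)
        moreover have "M' * \<bar>(u k)\<^sup>2 * v k / 2 - t\<^sup>2 / 2 / M'\<bar> = t\<^sup>2 / 2 * \<bar>v k / \<sigma>\<^sup>2 - 1\<bar>"
        proof -
          have "(u k)\<^sup>2 * v k / 2 - t\<^sup>2 / 2 / M' = (t\<^sup>2 / 2 / M') * (v k / \<sigma>\<^sup>2 - 1)"
            using M'(1) \<sigma>(1) unfolding u2 by (simp add: field_simps)
          then show ?thesis using M'(1) by (simp add: abs_mult)
        qed
        ultimately show ?thesis unfolding B_def by (simp add: distrib_left)
      qed
      finally show ?case unfolding M'_def by simp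
    qed
  qed
  have "(\<lambda>k. (1 + (- (t\<^sup>2) / 2) / real (m k)) ^ m k) \<longlonglongrightarrow> exp (- (t\<^sup>2) / 2)"
    by (rule filterlim_compose[OF tendsto_exp_limit_sequentially m])
  then have "(\<lambda>k. complex_of_real ((1 + (- (t\<^sup>2) / 2) / real (m k)) ^ m k)) \<longlonglongrightarrow> complex_of_real (exp (- (t\<^sup>2) / 2))"
    by (rule tendsto_of_real)
  moreover have "(\<lambda>k. \<phi> k ^ m k - complex_of_real ((1 + (- (t\<^sup>2) / 2) / real (m k)) ^ m k)) \<longlonglongrightarrow> 0"
    by (rule Lim_null_comparison[OF _ B_lim]) (use ev in simp)
  ultimately have "(\<lambda>k. \<phi> k ^ m k) \<longlonglongrightarrow> complex_of_real (exp (- (t\<^sup>2) / 2))"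
    by (rule Lim_transform)
  then show ?thesis unfolding \<phi>_def u_def W_def c_def by simp
qed

section \<open>The limit theorem\<close>

text \<open>Let \<open>y\<close> be the truncated ratio and \<open>N = n k\<close>. As
  \<open>y \<le> 1\<close> and the exponent \<open>1 + s * b\<close> is at most
  \<open>s + 1\<close>, \<open>N powr (1 + s * b) * y ^ Suc s\<close> is at most
  \<open>(y * N) powr (1 + s * b)\<close>, hence at most the same power of \<open>X\<close>: the
  moment dominates.\<close>

lemma normalised_moment_tendsto_0:
  fixes X :: "'w \<Rightarrow> nat" and Q :: "'w \<Rightarrow> real" and n :: "nat \<Rightarrow> nat"
  assumes X[measurable]: "X \<in> M \<rightarrow>\<^sub>M count_space UNIV" and Q[measurable]: "Q \<in> borel_measurable M"
    and Q01: "\<And>\<omega>. \<omega> \<in> space M \<Longrightarrow> Q \<omega> \<in> {0..1}"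
    and n: "filterlim n at_top sequentially"
    and s: "s > 0" and b: "0 \<le> b" "b < 1"
    and int: "integrable M (\<lambda>\<omega>. real (X \<omega>) powr (1 + real s * b) * Q \<omega> ^ s)"
  shows "(\<lambda>k. real (n k) powr (1 + real s * b) *
    (\<integral>\<omega>. Q \<omega> ^ s * (real (min (X \<omega>) (n k)) / real (n k)) ^ Suc s \<partial>M)) \<longlonglongrightarrow> 0"
proof -
  let ?c = "1 + real s * b"
  define f where "f k \<omega> = real (n k) powr ?c * (Q \<omega> ^ s * (real (min (X \<omega>) (n k)) / real (n k)) ^ Suc s)" for k \<omega>
  have meas [measurable]: "f k \<in> borel_measurable M" for k
    unfolding f_def by measurable
  have c: "0 < ?c" "?c \<le> real (Suc s)"
    using b s mult_left_mono[of b 1 "real s"] by (auto simp: add_pos_nonneg)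
  have n_real: "filterlim (\<lambda>k. real (n k)) at_top sequentially"
    using n by (rule filterlim_compose[OF filterlim_real_sequentially])
  have "(\<lambda>k. \<integral>\<omega>. f k \<omega> \<partial>M) \<longlonglongrightarrow> (\<integral>\<omega>. 0 \<partial>M)"
  proof (rule integral_dominated_convergence[where w = "\<lambda>\<omega>. real (X \<omega>) powr ?c * Q \<omega> ^ s"])
    show "AE \<omega> in M. norm (f k \<omega>) \<le> real (X \<omega>) powr ?c * Q \<omega> ^ s" for k
    proof (rule AE_I2)
      fix \<omega> assume \<omega>: "\<omega> \<in> space M"
      define N where "N = real (n k)"
      define y where "y = real (min (X \<omega>) (n k)) / real (n k)"
      have Q0: "0 \<le> Q \<omega> ^ s" using Q01[OF \<omega>] by simp
      have y: "0 \<le> y" "y \<le> 1" "y * N \<le> real (X \<omega>)"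
        unfolding y_def N_def by (auto simp: divide_le_eq_1)
      have "N powr ?c * y ^ Suc s \<le> real (X \<omega>) powr ?c"
      proof (cases "y = 0")
        case False
        then have "y > 0" using y by simp
        have "y ^ Suc s = y powr real (Suc s)" using \<open>y > 0\<close> by (rule powr_realpow[symmetric])
        also have "\<dots> \<le> y powr ?c" using c(2) y by (intro powr_mono') auto
        finally have "N powr ?c * y ^ Suc s \<le> N powr ?c * y powr ?c" by (intro mult_left_mono) auto
        also have "\<dots> = (y * N) powr ?c" using y by (simp add: powr_mult N_def mult.commute)
        also have "\<dots> \<le> real (X \<omega>) powr ?c" using y c(1) by (intro powr_mono2) (auto simp: N_def)
        finally show ?thesis .
      qed simp
      then have "(N powr ?c * y ^ Suc s) * Q \<omega> ^ s \<le> real (X \<omega>) powr ?c * Q \<omega> ^ s"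
        using Q0 by (rule mult_right_mono)
      moreover have "f k \<omega> = (N powr ?c * y ^ Suc s) * Q \<omega> ^ s"
        unfolding f_def y_def N_def by (simp only: ac_simps)
      moreover have "0 \<le> f k \<omega>" unfolding f_def using Q0 by simp
      ultimately show "norm (f k \<omega>) \<le> real (X \<omega>) powr ?c * Q \<omega> ^ s" by simp
    qed
    show "AE \<omega> in M. (\<lambda>k. f k \<omega>) \<longlonglongrightarrow> 0"
    proof (rule AE_I2)
      fix \<omega> assume \<omega>: "\<omega> \<in> space M"
      have Q0: "0 \<le> Q \<omega> ^ s" using Q01[OF \<omega>] by simp
      \<comment> \<open>The exponent equals \<open>s * (b - 1)\<close>, negative because
        \<open>b < 1\<close>.\<close>
      have "(\<lambda>k. real (n k) powr (?c - real (Suc s))) \<longlonglongrightarrow> 0"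
        using b s by (intro tendsto_neg_powr n_real) (simp add: mult_less_cancel_left1)
      then have lim: "(\<lambda>k. (Q \<omega> ^ s * real (X \<omega>) ^ Suc s) * real (n k) powr (?c - real (Suc s))) \<longlonglongrightarrow> 0"
        by (rule tendsto_mult_right_zero)
      have "\<forall>\<^sub>F k in sequentially. real (n k) \<ge> 1"
        using n_real unfolding filterlim_at_top by (rule spec)
      then have "\<forall>\<^sub>F k in sequentially. norm (f k \<omega>) \<le> (Q \<omega> ^ s * real (X \<omega>) ^ Suc s) * real (n k) powr (?c - real (Suc s))"
      proof eventually_elim
        case (elim k)
        have "(real (min (X \<omega>) (n k)) / real (n k)) ^ Suc s \<le> (real (X \<omega>) / real (n k)) ^ Suc s"
          by (intro power_mono divide_right_mono) auto
        also have "\<dots> = real (X \<omega>) ^ Suc s * real (n k) powr (- real (Suc s))"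
          using elim by (simp add: power_divide powr_minus powr_realpow divide_inverse power_mult_distrib power_inverse del: power_Suc of_nat_Suc)
        finally have "f k \<omega> \<le> real (n k) powr ?c * (Q \<omega> ^ s * (real (X \<omega>) ^ Suc s * real (n k) powr (- real (Suc s))))"
          unfolding f_def using Q0 by (intro mult_left_mono) auto
        also have "\<dots> = (Q \<omega> ^ s * real (X \<omega>) ^ Suc s) * (real (n k) powr ?c * real (n k) powr (- real (Suc s)))"
          by (simp only: ac_simps)
        also have "real (n k) powr ?c * real (n k) powr (- real (Suc s)) = real (n k) powr (?c - real (Suc s))"
          by (simp add: powr_add[symmetric])
        finally show ?case using Q0 by (simp add: f_def)
      qed
      then show "(\<lambda>k. f k \<omega>) \<longlonglongrightarrow> 0" using lim by (rule Lim_null_comparison)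
    qed
  qed (use int in auto)
  then show ?thesis unfolding f_def[abs_def] by simp
qed

lemma map_num_copies_layer_mixture:
  assumes \<kappa>: "\<And>A. measure_pmf.prob \<kappa> A = (\<integral>z. measure_pmf.prob (layer n (fst z) (snd z)) A \<partial>P)"
    and \<beta>: "\<And>A. measure_pmf.prob \<beta> A = (\<integral>z. measure_pmf.prob (bernoulli_graph {1..fst z} (snd z)) A \<partial>P)"
  shows "map_pmf (num_copies F) \<kappa> = map_pmf (\<lambda>G. num_copies F (induced {1..n} G)) \<beta>"
proof (rule pmf_eqI)
  fix j
  have "pmf (map_pmf (num_copies F) \<kappa>) j = (\<integral>z. pmf (map_pmf (num_copies F) (layer n (fst z) (snd z))) j \<partial>P)"
    unfolding pmf_map by (rule \<kappa>)
  also have "\<dots> = pmf (map_pmf (\<lambda>G. num_copies F (induced {1..n} G)) \<beta>) j"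
    unfolding map_num_copies_layer unfolding pmf_map by (rule \<beta>[symmetric])
  finally show "pmf (map_pmf (num_copies F) \<kappa>) j = pmf (map_pmf (\<lambda>G. num_copies F (induced {1..n} G)) \<beta>) j" .
qed

lemma expectation_Pi_pmf_component:
  fixes f :: "'b \<Rightarrow> 'c :: {banach, second_countable_topology}"
  assumes "finite I" "i \<in> I"
  shows "measure_pmf.expectation (Pi_pmf I d (\<lambda>_. \<kappa>)) (\<lambda>L. f (L i)) = measure_pmf.expectation \<kappa> f"
proof -
  have "map_pmf (\<lambda>L. L i) (Pi_pmf I d (\<lambda>_. \<kappa>)) = \<kappa>"
    using assms by (simp add: Pi_pmf_component)
  then show ?thesis by (metis integral_map_pmf)
qed

lemma expectation_Pi_pmf_iexp_sum:
  fixes g :: "'b \<Rightarrow> real"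
  assumes I: "finite I"
  shows "measure_pmf.expectation (Pi_pmf I d (\<lambda>_. \<kappa>)) (\<lambda>L. iexp (u * (\<Sum>i\<in>I. g (L i) - c)))
    = measure_pmf.expectation \<kappa> (\<lambda>G. iexp (u * (g G - c))) ^ card I"
proof (cases "I = {}")
  case False
  let ?L = "Pi_pmf I d (\<lambda>_. \<kappa>)"
  have "prob_space.indep_vars (measure_pmf ?L) (\<lambda>_. borel) (\<lambda>i L. iexp (u * (g (L i) - c))) I"
    by (rule prob_space.indep_vars_compose2[OF prob_space_measure_pmf indep_vars_Pi_pmf[OF I]]) simp
  then have "measure_pmf.expectation ?L (\<lambda>L. \<Prod>i\<in>I. iexp (u * (g (L i) - c)))
    = (\<Prod>i\<in>I. measure_pmf.expectation ?L (\<lambda>L. iexp (u * (g (L i) - c))))"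
    by (intro prob_space.indep_vars_lebesgue_integral[OF prob_space_measure_pmf I])
      (auto intro!: measure_pmf.integrable_const_bound[where B = 1])
  also have "\<dots> = measure_pmf.expectation \<kappa> (\<lambda>G. iexp (u * (g G - c))) ^ card I"
    using expectation_Pi_pmf_component[OF I, of _ d \<kappa> "\<lambda>G. iexp (u * (g G - c))"] by simp
  also have "(\<lambda>L. \<Prod>i\<in>I. iexp (u * (g (L i) - c))) = (\<lambda>L. iexp (u * (\<Sum>i\<in>I. g (L i) - c)))"
    using I by (simp add: exp_sum[symmetric] sum_distrib_left)
  finally show ?thesis .
qed simp

text \<open>Each variable is centred at its own mean, and the means differ by at most the L1
  distance; this is the source of the factor 2.\<close>

lemma norm_expectation_iexp_centred_diff_le:
  fixes f g :: "'a \<Rightarrow> real"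
  assumes fin: "finite (set_pmf p)"
  shows "cmod (measure_pmf.expectation p (\<lambda>x. iexp (u * (f x - measure_pmf.expectation p f)))
    - measure_pmf.expectation p (\<lambda>x. iexp (u * (g x - measure_pmf.expectation p g))))
    \<le> 2 * \<bar>u\<bar> * measure_pmf.expectation p (\<lambda>x. \<bar>f x - g x\<bar>)"
proof -
  let ?E = "measure_pmf.expectation p"
  have int: "integrable (measure_pmf p) h" for h :: "'a \<Rightarrow> 'b :: {banach, second_countable_topology}"
    by (rule integrable_measure_pmf_finite[OF fin])
  have "cmod (?E (\<lambda>x. iexp (u * (f x - ?E f))) - ?E (\<lambda>x. iexp (u * (g x - ?E g))))
    = cmod (?E (\<lambda>x. iexp (u * (f x - ?E f)) - iexp (u * (g x - ?E g))))"
    by (subst Bochner_Integration.integral_diff[OF int int]) (rule refl)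
  also have "\<dots> \<le> ?E (\<lambda>x. cmod (iexp (u * (f x - ?E f)) - iexp (u * (g x - ?E g))))"
    by (rule integral_norm_bound)
  also have "\<dots> \<le> ?E (\<lambda>x. \<bar>u\<bar> * (\<bar>f x - g x\<bar> + ?E (\<lambda>x. \<bar>f x - g x\<bar>)))"
  proof (rule integral_mono[OF int int])
    fix x
    have "\<bar>?E f - ?E g\<bar> \<le> ?E (\<lambda>x. \<bar>f x - g x\<bar>)"
      unfolding Bochner_Integration.integral_diff[OF int int, symmetric] by (rule integral_abs_bound)
    then have "\<bar>(f x - ?E f) - (g x - ?E g)\<bar> \<le> \<bar>f x - g x\<bar> + ?E (\<lambda>x. \<bar>f x - g x\<bar>)" by linarith
    then have "\<bar>u\<bar> * \<bar>(f x - ?E f) - (g x - ?E g)\<bar> \<le> \<bar>u\<bar> * (\<bar>f x - g x\<bar> + ?E (\<lambda>x. \<bar>f x - g x\<bar>))"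
      by (rule mult_left_mono) simp
    then show "cmod (iexp (u * (f x - ?E f)) - iexp (u * (g x - ?E g))) \<le> \<bar>u\<bar> * (\<bar>f x - g x\<bar> + ?E (\<lambda>x. \<bar>f x - g x\<bar>))"
      using norm_iexp_diff_le[of "u * (f x - ?E f)" "u * (g x - ?E g)"]
      by (simp only: right_diff_distrib[symmetric] abs_mult)
  qed
  also have "\<dots> = 2 * \<bar>u\<bar> * ?E (\<lambda>x. \<bar>f x - g x\<bar>)"
    by (simp add: int)
  finally show ?thesis .
qed

lemma set_pmf_mixed_bernoulli_graph:
  assumes \<beta>: "\<And>A. measure_pmf.prob \<beta> A = (\<integral>z. measure_pmf.prob (bernoulli_graph {1..fst z} (snd z)) A \<partial>P)"
    and G: "G \<in> set_pmf \<beta>"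
  obtains x where "verts G = {1..x}" "edges G \<subseteq> vertex_pairs {1..x}"
proof -
  let ?T = "{G :: nat ugraph. \<exists>x. verts G = {1..x} \<and> edges G \<subseteq> vertex_pairs {1..x}}"
  have "measure_pmf.prob (bernoulli_graph {1..x} p) (- ?T) = 0" for x p
    using bernoulli_graph_support[of "{1..x}" p] by (subst measure_pmf_zero_iff) auto
  then have "measure_pmf.prob \<beta> (- ?T) = 0" by (simp only: \<beta>) simp
  then have "G \<in> ?T" using G by (subst (asm) measure_pmf_zero_iff) auto
  then show thesis using that by blast
qed

theorem theorem1:
  fixes M :: "'w measure" and X :: "'w \<Rightarrow> nat" and Q :: "'w \<Rightarrow> real"
    and F :: "'a ugraph" and \<nu> :: real and n m :: "nat \<Rightarrow> nat"
  defines "P \<equiv> distr M (count_space UNIV \<Otimes>\<^sub>M borel) (\<lambda>\<omega>. (X \<omega>, Q \<omega>))"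
  defines "\<sigma> \<equiv> sqrt (prob_space.variance (mixed_bernoulli_graph P) (\<lambda>G. real (num_copies F G)))"
  assumes M: "prob_space M"
    and X: "X \<in> M \<rightarrow>\<^sub>M count_space UNIV"
    and Q: "Q \<in> borel_measurable M" "\<And>\<omega>. \<omega> \<in> space M \<Longrightarrow> Q \<omega> \<in> {0..1}"
    and \<nu>: "\<nu> > 0"
    and n: "filterlim n at_top sequentially"
    and m: "filterlim m at_top sequentially"
    and mn: "(\<lambda>k. real (m k) / real (n k)) \<longlonglongrightarrow> \<nu>"
    and F: "simple_graph F" "two_connected F" "card (verts F) \<ge> 3"
    and EX: "integrable M (\<lambda>\<omega>. real (X \<omega>))"
    and var_finite: "integrable (mixed_bernoulli_graph P) (\<lambda>G. (real (num_copies F G))\<^sup>2)"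
    and var_pos: "prob_space.variance (mixed_bernoulli_graph P) (\<lambda>G. real (num_copies F G)) > 0"
    and moments: "\<And>s. s \<in> {1..card (verts F) - 1} \<Longrightarrow>
      integrable M (\<lambda>\<omega>.
        real (X \<omega>) powr (1 + real s * (1 - 1 / (2 * real (card (edges F))))) * Q \<omega> ^ s)"
  shows "weak_conv_m
    (\<lambda>k. distr (layered_graph P (n k) (m k)) borel
      (\<lambda>G. (real (num_copies F G)
              - prob_space.expectation (layered_graph P (n k) (m k)) (\<lambda>G. real (num_copies F G)))
           / (\<sigma> * sqrt (real (m k)))))
    std_normal_distribution"
proof -
  interpret M: prob_space M by (rule M)
  note [measurable] = X Q(1)
  have XQ [measurable]: "(\<lambda>\<omega>. (X \<omega>, Q \<omega>)) \<in> M \<rightarrow>\<^sub>M count_space UNIV \<Otimes>\<^sub>M borel" by measurable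
  have P: "prob_space P" "sets P = sets (count_space UNIV \<Otimes>\<^sub>M borel)"
    unfolding P_def by (intro M.prob_space_distr XQ) simp
  let ?d = "\<lparr>verts = {}, edges = {}\<rparr> :: nat ugraph"
  let ?f = "\<lambda>G. real (num_copies F G)"
  define h where "h = card (verts F)"
  define e where "e = card (edges F)"
  define b where "b = 1 - 1 / (2 * real e)"
  have he: "h \<le> e" "3 \<le> h" using two_connected_card_edges[OF F] F(3) unfolding h_def e_def by auto
  then have b: "0 \<le> b" "b < 1" unfolding b_def by (auto simp: field_simps)

  \<comment> \<open>Mixture and layers as probability mass functions\<close>
  obtain \<beta> where \<beta>: "mixed_bernoulli_graph P = measure_pmf \<beta>"
    and \<beta>_prob: "\<And>A. measure_pmf.prob \<beta> A = (\<integral>z. measure_pmf.prob (bernoulli_graph {1..fst z} (snd z)) A \<partial>P)"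
    using mixed_bernoulli_graph_pmf[OF P] by blast
  have "\<forall>k. \<exists>\<kappa>. set_pmf \<kappa> \<subseteq> {G. verts G \<subseteq> {1..n k} \<and> edges G \<subseteq> vertex_pairs (verts G)} \<and>
    (\<forall>A. measure_pmf.prob \<kappa> A = (\<integral>z. measure_pmf.prob (layer (n k) (fst z) (snd z)) A \<partial>P)) \<and>
    layered_graph P (n k) (m k) = measure_pmf (map_pmf (union_layers (n k) (m k)) (Pi_pmf {1..m k} ?d (\<lambda>_. \<kappa>)))"
  proof
    fix k
    show "\<exists>\<kappa>. set_pmf \<kappa> \<subseteq> {G. verts G \<subseteq> {1..n k} \<and> edges G \<subseteq> vertex_pairs (verts G)} \<and>
      (\<forall>A. measure_pmf.prob \<kappa> A = (\<integral>z. measure_pmf.prob (layer (n k) (fst z) (snd z)) A \<partial>P)) \<and>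
      layered_graph P (n k) (m k) = measure_pmf (map_pmf (union_layers (n k) (m k)) (Pi_pmf {1..m k} ?d (\<lambda>_. \<kappa>)))"
      by (rule mixed_layer_pmf[OF P, of "n k" "m k"]) blast
  qed
  from choice[OF this] obtain \<kappa> where \<kappa>: "\<forall>k. set_pmf (\<kappa> k) \<subseteq> {G. verts G \<subseteq> {1..n k} \<and> edges G \<subseteq> vertex_pairs (verts G)} \<and>
    (\<forall>A. measure_pmf.prob (\<kappa> k) A = (\<integral>z. measure_pmf.prob (layer (n k) (fst z) (snd z)) A \<partial>P)) \<and>
    layered_graph P (n k) (m k) = measure_pmf (map_pmf (union_layers (n k) (m k)) (Pi_pmf {1..m k} ?d (\<lambda>_. \<kappa> k)))"
    by (rule exE)
  have \<kappa>_supp: "set_pmf (\<kappa> k) \<subseteq> {G. verts G \<subseteq> {1..n k} \<and> edges G \<subseteq> vertex_pairs (verts G)}"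
    and \<kappa>_prob: "measure_pmf.prob (\<kappa> k) B = (\<integral>z. measure_pmf.prob (layer (n k) (fst z) (snd z)) B \<partial>P)"
    and layered: "layered_graph P (n k) (m k)
      = measure_pmf (map_pmf (union_layers (n k) (m k)) (Pi_pmf {1..m k} ?d (\<lambda>_. \<kappa> k)))" for k B
    using spec[OF \<kappa>, of k] by blast+
  define \<Lambda> where "\<Lambda> k = Pi_pmf {1..m k} ?d (\<lambda>_. \<kappa> k)" for k
  define A where "A k L = ?f (union_layers (n k) (m k) L)" for k L
  define S where "S k L = (\<Sum>i\<in>{1..m k}. ?f (L i))" for k and L :: "nat \<Rightarrow> nat ugraph"
  define \<mu> where "\<mu> k s = (\<integral>\<omega>. Q \<omega> ^ s * (real (min (X \<omega>) (n k)) / real (n k)) ^ Suc s \<partial>M)" for k s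
  \<comment> \<open>Summing over all admissible \<open>s\<close> produces a single null sequence
    that works for every rank; \<open>r k = n powr (- b)\<close> is the cost of one unit of
    rank.\<close>
  define \<delta> where "\<delta> k = (\<Sum>s=1..h-1. real (m k) * (\<mu> k s * real (n k) powr (real s * b)))" for k
  define r where "r k = real (n k) powr (- b)" for k

  \<comment> \<open>Copies that use several layers are negligible\<close>
  have \<mu>_nonneg: "0 \<le> \<mu> k s" for k s
    unfolding \<mu>_def using Q(2) by (intro Bochner_Integration.integral_nonneg_AE AE_I2) auto
  have n_real: "filterlim (\<lambda>k. real (n k)) at_top sequentially"
    using n by (rule filterlim_compose[OF filterlim_real_sequentially])
  have n_pos: "\<forall>\<^sub>F k in sequentially. n k > 0"
    using spec[OF n[unfolded filterlim_at_top], of 1] by eventually_elim simp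
  have m_pos: "\<forall>\<^sub>F k in sequentially. m k > 0"
    using spec[OF m[unfolded filterlim_at_top], of 1] by eventually_elim simp

  have \<delta>_lim: "\<delta> \<longlonglongrightarrow> 0"
  proof -
    have "(\<lambda>k. real (m k) * (\<mu> k s * real (n k) powr (real s * b))) \<longlonglongrightarrow> 0" if s: "s \<in> {1..h-1}" for s
    proof -
      \<comment> \<open>One factor of \<open>n\<close> is traded against \<open>m\<close>: the ratio
        tends to \<open>\<nu>\<close> and the normalised moment to 0.\<close>
      have "(\<lambda>k. real (m k) / real (n k) * (real (n k) powr (1 + real s * b) * \<mu> k s)) \<longlonglongrightarrow> \<nu> * 0"
        unfolding \<mu>_def using s moments b
        by (intro tendsto_mult mn normalised_moment_tendsto_0[OF X Q n]) (auto simp: b_def e_def h_def)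
      moreover have "\<forall>\<^sub>F k in sequentially. real (m k) / real (n k) * (real (n k) powr (1 + real s * b) * \<mu> k s)
        = real (m k) * (\<mu> k s * real (n k) powr (real s * b))"
        using n_pos by eventually_elim (simp add: powr_add field_simps)
      ultimately show ?thesis by (simp add: tendsto_cong)
    qed
    then show ?thesis unfolding \<delta>_def[abs_def] by (intro tendsto_null_sum) auto
  qed

  have \<kappa>_le: "measure_pmf.prob (\<kappa> k) {G. E \<subseteq> edges G} \<le> \<mu> k (min (card E) (card (\<Union>E) - 1))"
    if E: "E \<subseteq> vertex_pairs {1..n k}" "E \<noteq> {}" and nk: "n k > 0" for k E
  proof -
    define s where "s = min (card E) (card (\<Union>E) - 1)"
    let ?p = "\<lambda>z. measure_pmf.prob (layer (n k) (fst z) (snd z)) {G. E \<subseteq> edges G}"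
    have meas: "?p \<in> borel_measurable (count_space UNIV \<Otimes>\<^sub>M borel)"
      using measurable_layer_prob[OF P] by (simp only: measurable_cong_sets[OF P(2) refl])
    have "measure_pmf.prob (\<kappa> k) {G. E \<subseteq> edges G} = (\<integral>\<omega>. ?p (X \<omega>, Q \<omega>) \<partial>M)"
      unfolding \<kappa>_prob unfolding P_def by (rule integral_distr[OF XQ meas])
    also have "\<dots> \<le> \<mu> k s"
      unfolding \<mu>_def
    proof (rule integral_mono)
      have "(\<lambda>\<omega>. ?p (X \<omega>, Q \<omega>)) \<in> borel_measurable M" by (rule measurable_compose[OF XQ meas])
      then show "integrable M (\<lambda>\<omega>. ?p (X \<omega>, Q \<omega>))"
        by (rule M.integrable_const_bound[where B = 1, rotated]) simp
      have "norm (Q \<omega> ^ s * (real (min (X \<omega>) (n k)) / real (n k)) ^ Suc s) \<le> 1" if "\<omega> \<in> space M" for \<omega>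
      proof -
        have "Q \<omega> ^ s * (real (min (X \<omega>) (n k)) / real (n k)) ^ Suc s \<le> 1 * 1"
          using Q(2)[OF that] nk by (intro mult_mono power_le_one) auto
        then show ?thesis using Q(2)[OF that] by simp
      qed
      then show "integrable M (\<lambda>\<omega>. Q \<omega> ^ s * (real (min (X \<omega>) (n k)) / real (n k)) ^ Suc s)"
        by (intro M.integrable_const_bound[where B = 1] AE_I2) simp_all
      show "?p (X \<omega>, Q \<omega>) \<le> Q \<omega> ^ s * (real (min (X \<omega>) (n k)) / real (n k)) ^ Suc s"
        if "\<omega> \<in> space M" for \<omega>
        using Q(2)[OF that] prob_layer_superset_le_rank[OF E _ _ nk s_def] by simp
    qed
    finally show ?thesis unfolding s_def .
  qed

  have \<mu>_le: "real (m k) * \<mu> k s \<le> \<delta> k * r k ^ s" if s: "s \<in> {1..h - 1}" and nk: "n k > 0" for k s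
  proof -
    have "r k ^ s = real (n k) powr (- (real s * b))"
      using nk unfolding r_def by (simp add: powr_realpow[symmetric] powr_powr mult.commute)
    then have "real (m k) * \<mu> k s = real (m k) * (\<mu> k s * real (n k) powr (real s * b)) * r k ^ s"
      using nk by (simp add: powr_minus)
    also have "\<dots> \<le> \<delta> k * r k ^ s"
      unfolding \<delta>_def r_def using s \<mu>_nonneg by (intro mult_right_mono member_le_sum) auto
    finally show ?thesis .
  qed
  have \<delta>_nonneg: "0 \<le> \<delta> k" for k
    unfolding \<delta>_def using \<mu>_nonneg by (intro sum_nonneg) auto
  have "\<forall>\<^sub>F k in sequentially. \<delta> k < 1"
    using \<delta>_lim by (rule order_tendstoD) simp
  then have L1: "\<forall>\<^sub>F k in sequentially. finite (set_pmf (\<Lambda> k)) \<and>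
    measure_pmf.expectation (\<Lambda> k) (\<lambda>L. \<bar>A k L - S k L\<bar>) \<le> fact e * \<delta> k * sqrt (real (n k))"
    using n_pos m_pos
  proof eventually_elim
    case (elim k)
    have r: "0 \<le> r k" "r k \<le> 1"
      using powr_mono[of "- b" 0 "real (n k)"] elim b unfolding r_def by auto
    note bound = expectation_abs_num_copies_union_diff_le[OF F elim(3) \<kappa>_supp[of k] \<kappa>_le[OF _ _ elim(2)]
        \<mu>_le[unfolded h_def, OF _ elim(2)] \<delta>_nonneg less_imp_le[OF elim(1)] r]
    \<comment> \<open>With \<open>b = 1 - 1 / (2 * e)\<close>, only the power
      \<open>1 / (2 * e)\<close> of \<open>n\<close> remains per vertex; over
      \<open>h \<le> e\<close> vertices this gives at most \<open>sqrt n\<close>.\<close>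
    have "real (n k) * r k = real (n k) powr (1 / (2 * real e))"
      using elim by (simp add: r_def b_def powr_diff powr_minus field_simps)
    then have "(real (n k) * r k) ^ h = real (n k) powr (real h / (2 * real e))"
      using elim by (simp add: powr_realpow[symmetric] powr_powr)
    also have "\<dots> \<le> real (n k) powr (1 / 2)"
      using elim he by (intro powr_mono) (auto simp: field_simps)
    finally have "(real (n k) * r k) ^ h \<le> sqrt (real (n k))" by (simp add: powr_half_sqrt)
    then have le: "fact e * \<delta> k * (real (n k) * r k) ^ h \<le> fact e * \<delta> k * sqrt (real (n k))"
      using \<delta>_nonneg by (intro mult_left_mono) auto
    show ?case
      unfolding \<Lambda>_def A_def S_def e_def
      by (rule conjI[OF bound(1) order_trans[OF bound(2) le[unfolded e_def h_def]]])
  qed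

  \<comment> \<open>The sum of the counts over the layers\<close>
  have \<sigma>2: "measure_pmf.variance \<beta> ?f = \<sigma>\<^sup>2" and \<sigma>: "\<sigma> > 0"
    using var_pos unfolding \<sigma>_def \<beta> by auto
  define Y where "Y k G = ?f (induced {1..n k} G)" for k G
  have map_nc: "map_pmf (num_copies F) (\<kappa> k) = map_pmf (\<lambda>G. num_copies F (induced {1..n k} G)) \<beta>" for k
    by (rule map_num_copies_layer_mixture[OF \<kappa>_prob \<beta>_prob])
  \<comment> \<open>Moves expectations from the laws \<open>\<kappa> k\<close>, which vary with
    \<open>k\<close>, to the single law \<open>\<beta>\<close>, where the variables
    \<open>Y k\<close> are dominated by one count.\<close>
  have \<kappa>_Y: "measure_pmf.expectation (\<kappa> k) (\<lambda>G. g (?f G)) = measure_pmf.expectation \<beta> (\<lambda>G. g (Y k G))"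
    for k and g :: "real \<Rightarrow> 'c :: {banach, second_countable_topology}"
    using arg_cong[OF map_nc, of "\<lambda>p. measure_pmf.expectation p (\<lambda>j. g (real j))"] by (simp add: Y_def)

  have S_char: "measure_pmf.expectation (\<Lambda> k) (\<lambda>L. iexp (u * (S k L - measure_pmf.expectation (\<Lambda> k) (S k))))
    = measure_pmf.expectation \<beta> (\<lambda>G. iexp (u * (Y k G - measure_pmf.expectation \<beta> (Y k)))) ^ m k"
    if fin: "finite (set_pmf (\<Lambda> k))" for k u
  proof -
    let ?c = "measure_pmf.expectation \<beta> (Y k)"
    have "measure_pmf.expectation (\<Lambda> k) (\<lambda>L. ?f (L i)) = ?c" if "i \<in> {1..m k}" for i
      unfolding \<Lambda>_def using that \<kappa>_Y[of k "\<lambda>x. x"]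
        expectation_Pi_pmf_component[of "{1..m k}" i ?d "\<kappa> k" ?f] by simp
    then have "measure_pmf.expectation (\<Lambda> k) (S k) = (\<Sum>i\<in>{1..m k}. ?c)"
      unfolding S_def
      by (subst Bochner_Integration.integral_sum) (auto intro: integrable_measure_pmf_finite[OF fin])
    then have "S k L - measure_pmf.expectation (\<Lambda> k) (S k) = (\<Sum>i\<in>{1..m k}. ?f (L i) - ?c)" for L
      unfolding S_def by (simp add: sum_subtractf)
    then show ?thesis
      using expectation_Pi_pmf_iexp_sum[of "{1..m k}" ?d "\<kappa> k" u ?f ?c] \<kappa>_Y[of k "\<lambda>x. iexp (u * (x - ?c))"]
      unfolding \<Lambda>_def[symmetric] by simp
  qed

  \<comment> \<open>Convergence of the characteristic functions\<close>
  let ?T = "\<lambda>k. distr (layered_graph P (n k) (m k)) borel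
      (\<lambda>G. (?f G - prob_space.expectation (layered_graph P (n k) (m k)) ?f) / (\<sigma> * sqrt (real (m k))))"
  show ?thesis
  proof (rule levy_continuity)
    show "real_distribution (?T k)" for k
      unfolding layered by (intro prob_space.real_distribution_distr prob_space_measure_pmf) simp
    show "real_distribution std_normal_distribution" by (rule real_dist_normal_dist)
    fix t
    define u where "u k = t / (\<sigma> * sqrt (real (m k)))" for k
    let ?EA = "\<lambda>k. measure_pmf.expectation (\<Lambda> k) (\<lambda>L. iexp (u k * (A k L - measure_pmf.expectation (\<Lambda> k) (A k))))"
    let ?ES = "\<lambda>k. measure_pmf.expectation (\<Lambda> k) (\<lambda>L. iexp (u k * (S k L - measure_pmf.expectation (\<Lambda> k) (S k))))"
    have char_T: "char (?T k) t = ?EA k" for k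
    proof -
      have "char (?T k) t = prob_space.expectation (layered_graph P (n k) (m k))
        (\<lambda>G. iexp (u k * (?f G - prob_space.expectation (layered_graph P (n k) (m k)) ?f)))"
        unfolding char_def layered u_def by (subst integral_distr) (auto simp: field_simps)
      then show ?thesis unfolding layered \<Lambda>_def[symmetric] by (simp add: A_def[abs_def])
    qed
    have "(\<lambda>k. measure_pmf.expectation \<beta> (\<lambda>G. iexp (u k * (Y k G - measure_pmf.expectation \<beta> (Y k)))) ^ m k)
      \<longlonglongrightarrow> complex_of_real (exp (- t\<^sup>2 / 2))"
      unfolding u_def
    proof (rule prob_space.dominated_array_char_tendsto[OF prob_space_measure_pmf _ _ _ _ _ m \<sigma> \<sigma>2])
      show "integrable (measure_pmf \<beta>) (\<lambda>G. (?f G)\<^sup>2)" using var_finite unfolding \<beta> .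
      show "AE G in measure_pmf \<beta>. \<forall>k. \<bar>Y k G\<bar> \<le> ?f G"
        unfolding AE_measure_pmf_iff
      proof (intro ballI allI)
        fix G k assume "G \<in> set_pmf \<beta>"
        then obtain x where "verts G = {1..x}" by (rule set_pmf_mixed_bernoulli_graph[OF \<beta>_prob])
        then show "\<bar>Y k G\<bar> \<le> ?f G" unfolding Y_def by (simp add: num_copies_induced_le)
      qed
      show "AE G in measure_pmf \<beta>. (\<lambda>k. Y k G) \<longlonglongrightarrow> ?f G"
        unfolding AE_measure_pmf_iff
      proof (rule ballI)
        fix G assume "G \<in> set_pmf \<beta>"
        then obtain x where x: "verts G = {1..x}" "edges G \<subseteq> vertex_pairs {1..x}"
          by (rule set_pmf_mixed_bernoulli_graph[OF \<beta>_prob])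
        \<comment> \<open>A fixed sample has \<open>x\<close> vertices, so its truncation is
          eventually the sample itself.\<close>
        have "\<forall>\<^sub>F k in sequentially. x \<le> n k" using n unfolding filterlim_at_top by (rule spec)
        then have "\<forall>\<^sub>F k in sequentially. Y k G = ?f G"
        proof eventually_elim
          case (elim k)
          then show ?case unfolding Y_def using x by (subst induced_superset) auto
        qed
        then show "(\<lambda>k. Y k G) \<longlonglongrightarrow> ?f G" by (rule tendsto_eventually)
      qed
    qed simp_all
    moreover have "\<forall>\<^sub>F k in sequentially. measure_pmf.expectation \<beta> (\<lambda>G. iexp (u k * (Y k G - measure_pmf.expectation \<beta> (Y k)))) ^ m k
      = ?ES k"
      using L1 by eventually_elim (simp only: S_char)
    ultimately have ES: "?ES \<longlonglongrightarrow> char std_normal_distribution t"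
      unfolding char_std_normal_distribution by (simp add: tendsto_cong)
    have "(\<lambda>k. ?EA k - ?ES k) \<longlonglongrightarrow> 0"
    proof (rule Lim_null_comparison)
      \<comment> \<open>The error is at most of order \<open>\<delta> k * sqrt (n k)\<close> and
        \<open>u k\<close> of order \<open>1 / sqrt (m k)\<close>. The quotient of the square roots
        stays bounded because \<open>m / n\<close> tends to \<open>\<nu> > 0\<close>, so
        \<open>\<delta> k\<close> forces the limit 0.\<close>
      let ?B = "\<lambda>k. 2 * \<bar>t\<bar> / \<sigma> * fact e * \<delta> k * inverse (sqrt (real (m k) / real (n k)))"
      have "?B \<longlonglongrightarrow> 2 * \<bar>t\<bar> / \<sigma> * fact e * 0 * inverse (sqrt \<nu>)"
        using \<nu> by (intro tendsto_intros \<delta>_lim mn) auto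
      then show "?B \<longlonglongrightarrow> 0" by simp
      show "\<forall>\<^sub>F k in sequentially. cmod (?EA k - ?ES k) \<le> ?B k"
        using L1 m_pos n_pos
      proof eventually_elim
        case (elim k)
        have "cmod (?EA k - ?ES k) \<le> 2 * \<bar>u k\<bar> * measure_pmf.expectation (\<Lambda> k) (\<lambda>L. \<bar>A k L - S k L\<bar>)"
          using elim by (intro norm_expectation_iexp_centred_diff_le) auto
        also have "\<dots> \<le> 2 * \<bar>u k\<bar> * (fact e * \<delta> k * sqrt (real (n k)))"
          using elim by (intro mult_left_mono) auto
        also have "\<dots> = ?B k"
          using \<sigma> elim by (simp add: u_def abs_mult real_sqrt_divide field_simps)
        finally show ?case .
      qed
    qed
    then have "?EA \<longlonglongrightarrow> char std_normal_distribution t" using ES by (rule Lim_transform[rotated])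
    then show "(\<lambda>k. char (?T k) t) \<longlonglongrightarrow> char std_normal_distribution t" by (simp only: char_T)
  qed
qed

end
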